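(* Let $(W,Y)$ and $(W',Y')$ be random vectors on a common probability space satisfying the following. (I) $\mathbb{E}W=0$, $\operatorname{Var}(W)=1$; $\mathbb{E}Y=0$, $\operatorname{Var}(Y)=\sigma_Y^2$; $W$ and $Y$ are uncorrelated; and $(W,Y,W',Y')\overset{d}{=}(W',Y',W,Y)$ (exchangeability). (II) $Y$ takes values in $\zeta+\mathbb{Z}$ for some $\zeta\in[0,1)$, $\Delta Y:=Y'-Y\in\{-1,0,1\}$ almost surely, and $M_{0,\pm}(W,Y)=Q+R_{0,\pm}$, where $Q=\lambda\sigma_Y^2$ for some $\lambda\in(0,1)$ and $R_{0,\pm}$ are random variables. (III) $M_{1,\pm}(W,Y)=-\lambda\left(\tfrac12\psi W+R_{1,\pm}\right)$ for some number $\psi>0$ and random variables $R_{1,\pm}$. (IV) $M_{2,\pm}(W,Y)=\lambda(\psi+R_{2,\pm})$ for random variables $R_{2,\pm}$. Let $k$ be such that $p_k:=\mathbb{P}(Y=k)>0$. Then $$d_W\big((W\mid Y=k),Z\big)\le \frac{2}{\psi}\Big(A_k+\frac{1}{p_k}C\Big)+\sqrt{\frac{2}{\pi\psi^2}}\Big(B_k+\frac1{p_k}D\Big)+\frac{2}{3\lambda\psi p_k}\,\mathbb{E}|\Delta W|^3,$$ where $A_k=\mathbb{E}(|R_{1,-}|\mid Y=k)$, $B_k=\mathbb{E}(|R_{2,-}|\mid Y=k)$, $C=\mathbb{E}|R_{1,+}-R_{1,-}|$, $D=\mathbb{E}|R_{2,+}-R_{2,-}|$, and $Z$ is a standard normal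 random variable.
   Context: $\Delta W:=W'-W$. For $\ell\ge0$, $M_{\ell,\pm}(W,Y):=\mathbb{E}\big((\Delta W)^\ell\,\mathbf{1}_{\{\Delta Y=\pm1\}}\mid W,Y\big)$ (the "+" and "−" versions being two separate quantities; in particular $M_{0,\pm}=\mathbb{P}(\Delta Y=\pm1\mid W,Y)$). For a random variable $V$ and event $B$ of positive probability, $d_W((V\mid B),Z):=\sup_h|\mathbb{E}(h(V)\mid B)-\mathbb{E}h(Z)|$, the supremum over all $1$-Lipschitz $h:\mathbb{R}\to\mathbb{R}$ (Wasserstein-1 distance). *)

theory Defs
  imports "HOL-Probability.Probability"
begin

definition sigma_WY :: "'a measure \<Rightarrow> ('a \<Rightarrow> real) \<Rightarrow> ('a \<Rightarrow> real) \<Rightarrow> 'a measure" where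
  "sigma_WY M W Y = vimage_algebra (space M) (\<lambda>\<omega>. (W \<omega>, Y \<omega>)) borel"

definition Mcond :: "'a measure \<Rightarrow> ('a \<Rightarrow> real) \<Rightarrow> ('a \<Rightarrow> real) \<Rightarrow> ('a \<Rightarrow> real) \<Rightarrow> ('a \<Rightarrow> real)
    \<Rightarrow> nat \<Rightarrow> real \<Rightarrow> 'a \<Rightarrow> real" where
  "Mcond M W Y W' Y' l s = real_cond_exp M (sigma_WY M W Y)
     (\<lambda>\<omega>. (W' \<omega> - W \<omega>) ^ l * (if Y' \<omega> - Y \<omega> = s then 1 else 0))"

definition cond_exp_event :: "'a measure \<Rightarrow> ('a \<Rightarrow> real) \<Rightarrow> 'a set \<Rightarrow> real" where
  "cond_exp_event M X B = (\<integral>\<omega>. X \<omega> * indicator B \<omega> \<partial>M) / measure M B"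

definition lipschitz1 :: "(real \<Rightarrow> real) \<Rightarrow> bool" where
  "lipschitz1 h \<longleftrightarrow> (\<forall>x y. \<bar>h x - h y\<bar> \<le> \<bar>x - y\<bar>)"

definition dW_cond_normal :: "'a measure \<Rightarrow> ('a \<Rightarrow> real) \<Rightarrow> 'a set \<Rightarrow> ennreal" where
  "dW_cond_normal M V B = (SUP h \<in> {h. lipschitz1 h}.
     ennreal \<bar>cond_exp_event M (\<lambda>\<omega>. h (V \<omega>)) B
              - (\<integral>x. std_normal_density x * h x \<partial>lborel)\<bar>)"

end

theory Submission
  imports Defs "HOL-Real_Asymp.Real_Asymp"
begin

text \<open>
  Let \<open>f\<close> solve Stein's equation \<open>f' x - x * f x = h x - E h(Z)\<close> for a 1-Lipschitz \<open>h\<close>, and let \<open>G' = f\<close>. Since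
  \<open>f\<close>, \<open>f'\<close> and the Lipschitz constant of \<open>f'\<close> are bounded by \<open>1\<close>, \<open>sqrt (2/pi)\<close> and \<open>2\<close>, a Taylor
  expansion with conditions (III) and (IV) gives
  \<open>2 * a k = lam * psi * E (f'(W) - W f(W); Y = k)\<close> up to the error terms at \<open>k\<close>, where
  \<open>a j = E (G(W') - G(W); Y = j, Y' = j - 1)\<close>. Put \<open>b j = E (G(W') - G(W); Y = j, Y' = j + 1)\<close>.
  Exchangeability gives \<open>a j = - b (j - 1)\<close>, and the same expansion shows that \<open>b j - a j\<close> only
  involves the differences \<open>R1p - R1m\<close>, \<open>R2p - R2m\<close> and third moments on \<open>{Y = j}\<close>. Alternating the
  two relations downwards from \<open>k\<close>, where \<open>a j\<close> tends to \<open>0\<close>, bounds \<open>a k\<close> by errors on the disjoint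
  events \<open>{Y = j}\<close>, \<open>j < k\<close>.
\<close>

section \<open>Gaussian tail integrals\<close>

text \<open>The event \<open>{Y = k}\<close> is not invariant under swapping the pair, so the usual
  argument that an antisymmetric function has mean zero says nothing on it. The increment of the
  antiderivative \<open>G\<close> is antisymmetric, and a swap trades a step down from
  \<open>j\<close> for a step up from \<open>j - 1\<close>. The unknown quantity can thus be pushed
  to levels where it vanishes, at the price of one error per level. As the levels are disjoint,
  these errors add up to one expectation over the whole space: hence \<open>C\<close>,
  \<open>D\<close> and the third moment are unconditioned and divided by \<open>p\<close>, while
  \<open>A\<close> and \<open>B\<close> are conditioned on \<open>Y = k\<close>. The leading
  coefficient of the expansion is \<open>lam * psi / 2\<close>, and dividing by it fixes the
  constants: the bound 1 on \<open>f\<close> gives the weight \<open>2 / psi\<close> of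
  \<open>A\<close> and \<open>C\<close>, half the bound \<open>sqrt (2/pi)\<close> on
  \<open>f'\<close> gives that of \<open>B\<close> and \<open>D\<close>, and the Lipschitz constant
  2 of \<open>f'\<close> gives the Taylor remainder \<open>\<bar>W' - W\<bar> ^ 3 / 3\<close>. The
  stated bound therefore needs exactly these three constants; \<open>sqrt (2/pi)\<close> costs the
  longest Gaussian estimate.\<close>

lemma le_of_DERIV_nonneg_at_bot:
  fixes F F' :: "real \<Rightarrow> real"
  assumes "\<And>x. (F has_real_derivative F' x) (at x)" "\<And>x. F' x \<ge> 0" "(F \<longlongrightarrow> l) at_bot"
  shows "l \<le> F x"
proof (rule tendsto_upperbound[OF assms(3)])
  have "F y \<le> F x" if "y \<le> x" for y
    by (rule DERIV_nonneg_imp_nondecreasing[OF that]) (use assms(1,2) in blast)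
  then show "\<forall>\<^sub>F y in at_bot. F y \<le> F x"
    by (rule eventually_mono[OF eventually_le_at_bot[of x]])
qed simp

abbreviation std_normal_mean :: "(real \<Rightarrow> real) \<Rightarrow> real" where
  "std_normal_mean g \<equiv> (\<integral>z. std_normal_density z * g z \<partial>lborel)"

text \<open>For the constant function 1 this is the normal distribution function, and
  \<open>gauss_upper\<close> is its tail.\<close>

definition gauss_lower :: "(real \<Rightarrow> real) \<Rightarrow> real \<Rightarrow> real" where
  "gauss_lower g x = (LINT z:{..x}|lborel. std_normal_density z * g z)"

definition gauss_upper :: "(real \<Rightarrow> real) \<Rightarrow> real \<Rightarrow> real" where
  "gauss_upper g x = (LINT z:{x<..}|lborel. std_normal_density z * g z)"

abbreviation gauss_integrable :: "(real \<Rightarrow> real) \<Rightarrow> bool" where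
  "gauss_integrable g \<equiv> integrable lborel (\<lambda>z. std_normal_density z * g z)"

lemma set_integrable_of_integrable:
  assumes "integrable M f" "A \<in> sets M"
  shows "set_integrable M A (f :: _ \<Rightarrow> real)"
  using assms unfolding set_integrable_def by (intro integrable_mult_indicator)

lemma gauss_lower_plus_upper:
  assumes "gauss_integrable g"
  shows "gauss_lower g x + gauss_upper g x = std_normal_mean g"
proof -
  have "{..x} \<union> {x<..} = UNIV" by auto
  then show ?thesis
    unfolding gauss_lower_def gauss_upper_def using assms
    by (subst set_integral_Un[symmetric])
       (auto intro!: set_integrable_of_integrable simp: set_lebesgue_integral_def)
qed

lemma gauss_lower_tendsto_at_bot:
  assumes "gauss_integrable g"
  shows "(gauss_lower g \<longlongrightarrow> 0) at_bot"
proof -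
  have "((\<lambda>x. \<integral>z. indicator {..-x} z *\<^sub>R (std_normal_density z * g z) \<partial>lborel) \<longlongrightarrow> (\<integral>z. 0 \<partial>(lborel::real measure))) at_top"
  proof (rule integral_dominated_convergence_at_top)
    show "integrable lborel (\<lambda>z. norm (std_normal_density z * g z))"
      using assms by (rule integrable_norm)
    show "AE z in lborel. ((\<lambda>x. indicat_real {..-x} z *\<^sub>R (std_normal_density z * g z)) \<longlongrightarrow> 0) at_top"
    proof (rule AE_I2)
      fix z :: real
      have "\<forall>\<^sub>F x in at_top. indicat_real {..-x} z *\<^sub>R (std_normal_density z * g z) = 0"
        using eventually_gt_at_top[of "-z"] by eventually_elim (auto simp: indicator_def)
      then show "((\<lambda>x. indicat_real {..-x} z *\<^sub>R (std_normal_density z * g z)) \<longlongrightarrow> 0) at_top"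
        by (rule tendsto_eventually)
    qed
    show "\<forall>\<^sub>F x in at_top. AE z in lborel. norm (indicat_real {..-x} z *\<^sub>R (std_normal_density z * g z)) \<le> norm (std_normal_density z * g z)"
      by (intro always_eventually allI AE_I2) (auto simp: indicator_def)
  qed (use borel_measurable_integrable[OF assms] in measurable)
  then have "((\<lambda>x. gauss_lower g (-x)) \<longlongrightarrow> 0) at_top"
    by (simp add: gauss_lower_def set_lebesgue_integral_def)
  then show ?thesis
    by (subst filterlim_at_bot_mirror)
qed

lemma gauss_lower_has_derivative:
  assumes g: "gauss_integrable g" and cont: "continuous_on UNIV g"
  shows "(gauss_lower g has_real_derivative std_normal_density x * g x) (at x)"
proof -
  let ?q = "\<lambda>z. std_normal_density z * g z"
  have q: "continuous_on {x-1..x+1} ?q"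
    unfolding normal_density_def by (intro continuous_intros continuous_on_subset[OF cont]) auto
  \<comment> \<open>Only the integral over a compact interval varies with \<open>y\<close>, which
    puts the fundamental theorem of calculus within reach; \<open>x-1\<close> is just some point to
    the left of \<open>x\<close>.\<close>
  have split: "gauss_lower g y = gauss_lower g (x-1) + integral {x-1..y} ?q" if "y \<ge> x - 1" for y
  proof -
    have "{..y} = {..x-1} \<union> {x-1<..y}" using that by auto
    then have "gauss_lower g y = gauss_lower g (x-1) + (LINT z:{x-1<..y}|lborel. ?q z)"
      unfolding gauss_lower_def
      by (simp only:) (rule set_integral_Un; auto intro!: set_integrable_of_integrable g)
    also have "(LINT z:{x-1<..y}|lborel. ?q z) = (LINT z:{x-1..y}|lborel. ?q z)"
      unfolding set_lebesgue_integral_def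
      by (rule integral_cong_AE)
         (use borel_measurable_integrable[OF g] AE_lborel_singleton[of "x-1"] in \<open>auto elim!: eventually_mono split: split_indicator\<close>)
    also have "\<dots> = integral {x-1..y} ?q"
      by (rule set_borel_integral_eq_integral) (simp add: set_integrable_of_integrable g)
    finally show ?thesis .
  qed
  have "((\<lambda>y. integral {x-1..y} ?q) has_real_derivative ?q x) (at x within {x-1..x+1})"
    by (rule integral_has_real_derivative[OF q]) auto
  then have "((\<lambda>y. integral {x-1..y} ?q) has_real_derivative ?q x) (at x)"
    by (simp add: at_within_Icc_at)
  then have "((\<lambda>y. gauss_lower g (x-1) + integral {x-1..y} ?q) has_real_derivative ?q x) (at x)"
    by (auto intro!: derivative_eq_intros)
  then show ?thesis
  proof (rule has_field_derivative_transform_within_open[where S="{x-1<..}"])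
    fix y assume "y \<in> {x-1<..}"
    then show "gauss_lower g (x-1) + integral {x-1..y} ?q = gauss_lower g y"
      by (intro split[symmetric]) simp
  qed auto
qed

lemma gauss_integrable_const: "gauss_integrable (\<lambda>_. c)"
  using integrable_std_normal_moment[of 0] by simp

lemma gauss_integrable_id: "gauss_integrable (\<lambda>z. z)"
  using integrable_std_normal_moment[of 1] by simp

lemma std_normal_mean_const: "std_normal_mean (\<lambda>_. c) = c"
  using integral_std_normal_moment_even[of 0] by simp

lemma std_normal_mean_id: "std_normal_mean (\<lambda>z. z) = 0"
  using integral_std_normal_moment_odd[of 0] by simp

lemma gauss_lower_mono:
  assumes "gauss_integrable g" "gauss_integrable k" "\<And>z. z \<le> x \<Longrightarrow> g z \<le> k z"
  shows "gauss_lower g x \<le> gauss_lower k x"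
  unfolding gauss_lower_def using assms
  by (intro set_integral_mono) (auto intro!: set_integrable_of_integrable mult_left_mono)

lemma gauss_upper_mono:
  assumes "gauss_integrable g" "gauss_integrable k" "\<And>z. z > x \<Longrightarrow> g z \<le> k z"
  shows "gauss_upper g x \<le> gauss_upper k x"
  unfolding gauss_upper_def using assms
  by (intro set_integral_mono) (auto intro!: set_integrable_of_integrable mult_left_mono)

lemma gauss_lower_diff:
  assumes "gauss_integrable g" "gauss_integrable k"
  shows "gauss_lower (\<lambda>z. g z - k z) x = gauss_lower g x - gauss_lower k x"
  unfolding gauss_lower_def using assms
  by (simp add: right_diff_distrib set_integrable_of_integrable)

lemma gauss_upper_diff:
  assumes "gauss_integrable g" "gauss_integrable k"
  shows "gauss_upper (\<lambda>z. g z - k z) x = gauss_upper g x - gauss_upper k x"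
  unfolding gauss_upper_def using assms
  by (simp add: right_diff_distrib set_integrable_of_integrable)

lemma gauss_lower_const: "gauss_lower (\<lambda>_. c) x = c * gauss_lower (\<lambda>_. 1) x"
  unfolding gauss_lower_def by (simp add: mult.commute)

lemma gauss_upper_const: "gauss_upper (\<lambda>_. c) x = c * gauss_upper (\<lambda>_. 1) x"
  unfolding gauss_upper_def by (simp add: mult.commute)

lemma std_normal_density_has_derivative [derivative_intros]:
  "(std_normal_density has_real_derivative - x * std_normal_density x) (at x)"
  unfolding std_normal_density_def by (auto intro!: derivative_eq_intros simp: field_simps)

lemma std_normal_density_minus: "std_normal_density (-x) = std_normal_density x"
  by (simp add: std_normal_density_def)

lemma std_normal_density_tendsto_at_bot: "(std_normal_density \<longlongrightarrow> 0) at_bot"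
  unfolding std_normal_density_def by real_asymp

text \<open>Both sides have the derivative \<open>x * std_normal_density x\<close> and vanish at
  minus infinity; monotonicity is applied to the difference and to its negative.\<close>

lemma gauss_lower_id: "gauss_lower (\<lambda>z. z) x = - std_normal_density x"
proof -
  let ?F = "\<lambda>x. gauss_lower (\<lambda>z. z) x + std_normal_density x"
  have d: "(?F has_real_derivative 0) (at x)" for x
    by (auto intro!: derivative_eq_intros gauss_lower_has_derivative gauss_integrable_id)
  have l: "(?F \<longlongrightarrow> 0) at_bot"
    using tendsto_add[OF gauss_lower_tendsto_at_bot[OF gauss_integrable_id] std_normal_density_tendsto_at_bot] by simp
  have "?F x \<ge> 0"
    by (rule le_of_DERIV_nonneg_at_bot[OF d _ l]) simp
  moreover have "- ?F x \<ge> 0"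
    by (rule le_of_DERIV_nonneg_at_bot[where F="\<lambda>x. - ?F x"])
       (use DERIV_minus[OF d] tendsto_minus[OF l] in auto)
  ultimately show ?thesis by linarith
qed

lemma gauss_upper_id: "gauss_upper (\<lambda>z. z) x = std_normal_density x"
  using gauss_lower_plus_upper[OF gauss_integrable_id, of x] gauss_lower_id[of x] std_normal_mean_id by simp

lemma gauss_lower_plus_upper_1: "gauss_lower (\<lambda>_. 1) x + gauss_upper (\<lambda>_. 1) x = 1"
  using gauss_lower_plus_upper[OF gauss_integrable_const[of 1], of x] std_normal_mean_const[of 1] by simp

lemma gauss_lower_nonneg: "gauss_lower (\<lambda>_. 1) x \<ge> 0"
  unfolding gauss_lower_def set_lebesgue_integral_def by (rule Bochner_Integration.integral_nonneg) auto

lemma gauss_upper_nonneg: "gauss_upper (\<lambda>_. 1) x \<ge> 0"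
  unfolding gauss_upper_def set_lebesgue_integral_def by (rule Bochner_Integration.integral_nonneg) auto

lemma gauss_lower_minus: "gauss_lower (\<lambda>_. 1) (-x) = gauss_upper (\<lambda>_. 1) x"
proof -
  have "gauss_lower (\<lambda>_. 1) (-x) = (\<integral>z. indicator {x..} z * std_normal_density z \<partial>lborel)"
    unfolding gauss_lower_def set_lebesgue_integral_def
    by (subst lborel_integral_real_affine[where c="-1" and t=0])
       (auto simp: std_normal_density_minus indicator_def intro!: Bochner_Integration.integral_cong)
  also have "\<dots> = gauss_upper (\<lambda>_. 1) x"
    unfolding gauss_upper_def set_lebesgue_integral_def
    by (rule integral_cong_AE)
       (use AE_lborel_singleton[of x] in \<open>auto elim!: eventually_mono split: split_indicator\<close>)
  finally show ?thesis .
qed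

text \<open>The classical Mills ratio bound. After division by \<open>1 + x\<^sup>2\<close> the
  difference of the two sides vanishes at minus infinity and has a positive derivative.\<close>

lemma gauss_lower_mills: "- x * std_normal_density x \<le> (1 + x\<^sup>2) * gauss_lower (\<lambda>_. 1) x"
proof -
  let ?F = "\<lambda>x. gauss_lower (\<lambda>_. 1) x + x / (1 + x\<^sup>2) * std_normal_density x"
  have p: "1 + x\<^sup>2 > 0" for x :: real by (simp add: add_pos_nonneg)
  have d: "(?F has_real_derivative 2 * std_normal_density x / (1 + x\<^sup>2)\<^sup>2) (at x)" for x
  proof -
    have "((\<lambda>x. x / (1 + x\<^sup>2)) has_real_derivative (1 - x\<^sup>2) / (1 + x\<^sup>2)\<^sup>2) (at x)"
      using p[of x] by (auto intro!: derivative_eq_intros simp: power2_eq_square)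
    from DERIV_add[OF gauss_lower_has_derivative[OF gauss_integrable_const[of 1]] DERIV_mult[OF this std_normal_density_has_derivative]]
    have "(?F has_real_derivative std_normal_density x + ((1 - x\<^sup>2) / (1 + x\<^sup>2)\<^sup>2 * std_normal_density x
        + - x * std_normal_density x * (x / (1 + x\<^sup>2)))) (at x)" by simp
    also have "std_normal_density x + ((1 - x\<^sup>2) / (1 + x\<^sup>2)\<^sup>2 * std_normal_density x
        + - x * std_normal_density x * (x / (1 + x\<^sup>2))) = 2 * std_normal_density x / (1 + x\<^sup>2)\<^sup>2"
    proof -
      have "u + ((1 - t) / (1 + t)\<^sup>2 * u - t * u / (1 + t)) = 2 * u / (1 + t)\<^sup>2" if "1 + t > 0" for t u :: real
        using that by (simp add: divide_simps) (simp add: algebra_simps power2_eq_square)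
      from this[OF p[of x], of "std_normal_density x"] show ?thesis
        by (simp add: power2_eq_square mult_ac)
    qed
    finally show ?thesis .
  qed
  have "((\<lambda>x::real. x / (1 + x\<^sup>2)) \<longlongrightarrow> 0) at_bot" by real_asymp
  from tendsto_add[OF gauss_lower_tendsto_at_bot[OF gauss_integrable_const[of 1]] tendsto_mult[OF this std_normal_density_tendsto_at_bot]]
  have l: "(?F \<longlongrightarrow> 0) at_bot" by simp
  have "?F x \<ge> 0" by (rule le_of_DERIV_nonneg_at_bot[OF d _ l]) simp
  then show ?thesis using p[of x] by (simp add: field_simps)
qed

lemma gauss_upper_mills: "x * std_normal_density x \<le> (1 + x\<^sup>2) * gauss_upper (\<lambda>_. 1) x"
  using gauss_lower_mills[of "-x"] by (simp add: gauss_lower_minus std_normal_density_minus)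

text \<open>
  The left-hand side is \<open>E \<bar>Z - x\<bar>\<close>. After division by \<open>x\<close>, the difference \<open>D\<close> of the two sides tends to
  \<open>0\<close> at \<open>0\<close> and at infinity, and its derivative has the sign of \<open>- K (x\<^sup>2)\<close> for a convex \<open>K\<close> with
  \<open>K 0 = 0\<close>; hence \<open>D\<close> first increases and then decreases.
\<close>

lemma gauss_fold_bound_pos:
  assumes "x > 0"
  shows "2 * std_normal_density x + x * (2 * gauss_lower (\<lambda>_. 1) x - 1) \<le> sqrt (x\<^sup>2 + 2 / pi * exp (- x\<^sup>2 / 2))"
proof -
  \<comment> \<open>\<open>K (x\<^sup>2) \<le> 0\<close> is the inequality
    \<open>D' x \<ge> 0\<close> with denominators cleared and both sides squared. \<open>v x\<close>
    is the square of the right-hand side of the claim, divided by \<open>x\<^sup>2\<close>.\<close>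
  define K :: "real \<Rightarrow> real" where "K = (\<lambda>t. (t + 2)\<^sup>2 - 2 * pi * t - 4 * exp (- t / 2))"
  define v :: "real \<Rightarrow> real" where "v = (\<lambda>x. 1 + 2 / pi * exp (- x\<^sup>2 / 2) / x\<^sup>2)"
  define P :: "real \<Rightarrow> real" where "P = (\<lambda>x. 2 * gauss_lower (\<lambda>_. 1) x - 1)"
  define D where "D = (\<lambda>x. sqrt (v x) - 2 * std_normal_density x / x - P x)"
  define D' where "D' = (\<lambda>x. exp (- x\<^sup>2 / 2) / x\<^sup>2 * (2 / sqrt (2 * pi) - (x\<^sup>2 + 2) / (pi * x * sqrt (v x))))"
  have vpos: "v x > 0" for x
    unfolding v_def by (intro add_pos_nonneg) auto
  have xv: "x * sqrt (v x) = sqrt (x\<^sup>2 + 2 / pi * exp (- x\<^sup>2 / 2))" if "x > 0" for x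
  proof -
    have "x * sqrt (v x) = sqrt (x\<^sup>2 * v x)" using that by (simp add: real_sqrt_mult)
    also have "x\<^sup>2 * v x = x\<^sup>2 + 2 / pi * exp (- x\<^sup>2 / 2)" using that by (simp add: v_def field_simps)
    finally show ?thesis .
  qed
  have Pd: "(P has_real_derivative 2 * std_normal_density x) (at x)" for x
    unfolding P_def using gauss_lower_has_derivative[OF gauss_integrable_const[of 1], of x]
    by (auto intro!: derivative_eq_intros)
  have deriv: "(D has_real_derivative D' x) (at x)" if "x > 0" for x
  proof -
    have "(v has_real_derivative - (2 / pi * exp (- x\<^sup>2 / 2) * (x\<^sup>2 + 2) / x^3)) (at x)"
      unfolding v_def using that
      by (auto intro!: derivative_eq_intros simp: field_simps power2_eq_square power3_eq_cube)
    from DERIV_chain2[where f=sqrt and g=v, OF DERIV_real_sqrt[OF vpos[of x]] this]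
    have 1: "((\<lambda>x. sqrt (v x)) has_real_derivative
        - (2 / pi * exp (- x\<^sup>2 / 2) * (x\<^sup>2 + 2) / x^3) * (inverse (sqrt (v x)) / 2)) (at x)"
      by (simp only: mult.commute)
    have 2: "((\<lambda>x. 2 * std_normal_density x / x) has_real_derivative
        (- 2 * std_normal_density x - 2 * std_normal_density x / x\<^sup>2)) (at x)"
      using that by (auto intro!: derivative_eq_intros simp: field_simps power2_eq_square)
    have "- (2 / pi * exp (- x\<^sup>2 / 2) * (x\<^sup>2 + 2) / x^3) * (inverse (sqrt (v x)) / 2)
        - (- 2 * std_normal_density x - 2 * std_normal_density x / x\<^sup>2) - 2 * std_normal_density x = D' x"
      unfolding D'_def std_normal_density_def using that vpos[of x]
      by (simp add: divide_simps) (simp add: algebra_simps power2_eq_square power3_eq_cube)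
    with DERIV_diff[OF DERIV_diff[OF 1 2] Pd[of x]] show ?thesis
      unfolding D_def by simp
  qed
  have sign: "D' x \<ge> 0 \<longleftrightarrow> K (x\<^sup>2) \<le> 0" if "x > 0" for x
  proof -
    have "D' x \<ge> 0 \<longleftrightarrow> (x\<^sup>2 + 2) / (pi * (x * sqrt (v x))) \<le> 2 / sqrt (2 * pi)"
      unfolding D'_def using that by (simp add: zero_le_mult_iff zero_le_divide_iff mult.assoc)
    also have "\<dots> \<longleftrightarrow> x\<^sup>2 + 2 \<le> 2 * pi * (x * sqrt (v x)) / sqrt (2 * pi)"
      using that vpos[of x] by (simp add: field_simps)
    also have "2 * pi * (x * sqrt (v x)) / sqrt (2 * pi) = sqrt (2 * pi) * (x * sqrt (v x))"
      by (simp add: field_simps)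
    also have "\<dots> = sqrt (2 * pi * (x\<^sup>2 + 2 / pi * exp (- x\<^sup>2 / 2)))"
      unfolding xv[OF that] by (simp add: real_sqrt_mult)
    also have "x\<^sup>2 + 2 \<le> \<dots> \<longleftrightarrow> (x\<^sup>2 + 2)\<^sup>2 \<le> 2 * pi * (x\<^sup>2 + 2 / pi * exp (- x\<^sup>2 / 2))"
      using real_sqrt_le_iff[of "(x\<^sup>2 + 2)\<^sup>2" "2 * pi * (x\<^sup>2 + 2 / pi * exp (- x\<^sup>2 / 2))"]
      by (simp add: add_nonneg_nonneg abs_of_nonneg)
    also have "2 * pi * (x\<^sup>2 + 2 / pi * exp (- x\<^sup>2 / 2)) = 2 * pi * x\<^sup>2 + 4 * exp (- x\<^sup>2 / 2)"
      by (simp add: field_simps)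
    also have "(x\<^sup>2 + 2)\<^sup>2 \<le> \<dots> \<longleftrightarrow> K (x\<^sup>2) \<le> 0"
      unfolding K_def by auto
    finally show ?thesis .
  qed
  \<comment> \<open>Convexity with \<open>K 0 = 0\<close>: a nonpositive value of \<open>K\<close>
    spreads to all smaller arguments, a positive one to all larger arguments.\<close>
  have K: "K (r * t) \<le> r * K t" if "0 \<le> r" "r \<le> 1" "t \<ge> 0" for r t
  proof -
    have "convex_on {0..} K"
      unfolding K_def
    proof (rule f''_ge0_imp_convex)
      show "((\<lambda>t. (t + 2)\<^sup>2 - 2 * pi * t - 4 * exp (- t / 2)) has_real_derivative
          2 * (t + 2) - 2 * pi + 2 * exp (- t / 2)) (at t)" for t
        by (auto intro!: derivative_eq_intros)
      show "((\<lambda>t. 2 * (t + 2) - 2 * pi + 2 * exp (- t / 2)) has_real_derivative 2 - exp (- t / 2)) (at t)" for t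
        by (auto intro!: derivative_eq_intros)
      show "0 \<le> 2 - exp (- t / 2)" if "t \<in> {0..}" for t :: real
        using exp_le_one_iff[of "-t/2"] that by (simp del: exp_le_one_iff)
    qed auto
    from convex_onD[OF this, of r 0 t] that show ?thesis by (simp add: K_def)
  qed
  have "D x \<ge> 0"
  proof (cases "K (x\<^sup>2) \<le> 0")
    case True
    \<comment> \<open>\<open>D\<close> increases on \<open>(0, x]\<close>, and near 0 the singular
      terms of \<open>D u\<close> satisfy
      \<open>2 * std_normal_density u / u \<le> sqrt (v u)\<close>, so only \<open>- P u\<close> is
      left; it tends to \<open>- P 0 = 0\<close>.\<close>
    have up: "- P u \<le> D x" if "0 < u" "u \<le> x" for u
    proof -
      have D'_nonneg: "D' t \<ge> 0" if "0 < t" "t \<le> x" for t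
      proof -
        have "K (t\<^sup>2) = K (t\<^sup>2 / x\<^sup>2 * x\<^sup>2)" using assms by simp
        also have "\<dots> \<le> t\<^sup>2 / x\<^sup>2 * K (x\<^sup>2)" using that assms by (intro K) (auto simp: power_mono)
        also have "\<dots> \<le> 0" using True by (intro mult_nonneg_nonpos) auto
        finally show ?thesis using sign that by blast
      qed
      have "D u \<le> D x"
      proof (rule DERIV_nonneg_imp_nondecreasing[OF \<open>u \<le> x\<close>])
        fix t assume "u \<le> t" "t \<le> x"
        then show "\<exists>y. (D has_real_derivative y) (at t) \<and> 0 \<le> y"
          using deriv[of t] D'_nonneg[of t] \<open>0 < u\<close> by (intro exI[of _ "D' t"]) auto
      qed
      moreover have "2 * std_normal_density u / u \<le> sqrt (v u)"
      proof (rule real_le_rsqrt)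
        have "(2 * std_normal_density u / u)\<^sup>2 = 2 / pi * (exp (- u\<^sup>2 / 2) * exp (- u\<^sup>2 / 2)) / u\<^sup>2"
          by (simp add: std_normal_density_def power_mult_distrib power_divide power2_eq_square[of "exp _"] )
        also have "\<dots> \<le> 2 / pi * (exp (- u\<^sup>2 / 2) * 1) / u\<^sup>2"
          by (intro divide_right_mono mult_left_mono) auto
        also have "\<dots> \<le> v u" by (simp add: v_def)
        finally show "(2 * std_normal_density u / u)\<^sup>2 \<le> v u" .
      qed
      ultimately show ?thesis by (simp add: D_def)
    qed
    have "isCont P 0" using Pd by (rule DERIV_isCont)
    then have "((\<lambda>u. - P u) \<longlongrightarrow> - P 0) (at_right 0)"
      by (intro tendsto_minus) (auto simp: isCont_def intro: filterlim_at_split[THEN iffD1, THEN conjunct2])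
    moreover have "P 0 = 0"
      using gauss_lower_minus[of 0] gauss_lower_plus_upper_1[of 0] by (simp add: P_def)
    ultimately have "((\<lambda>u. - P u) \<longlongrightarrow> 0) (at_right 0)" by simp
    then show ?thesis
    proof (rule tendsto_upperbound)
      show "\<forall>\<^sub>F u in at_right 0. - P u \<le> D x"
        using eventually_at_right_less[of 0] eventually_at_right_real[OF assms]
        by eventually_elim (auto intro: up)
    qed simp
  next
    case False
    \<comment> \<open>\<open>D\<close> decreases from \<open>x\<close> on, and far out
      \<open>sqrt (v u) \<ge> 1 \<ge> P u\<close> leaves only the density term, which is at most
      \<open>1 / u\<close>.\<close>
    have up: "- (1 / u) \<le> D x" if "x \<le> u" for u
    proof -
      have D'_nonpos: "D' t \<le> 0" if "x \<le> t" for t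
      proof -
        have t: "t > 0" using that assms by simp
        have "K (x\<^sup>2) = K (x\<^sup>2 / t\<^sup>2 * t\<^sup>2)" using t by simp
        also have "\<dots> \<le> x\<^sup>2 / t\<^sup>2 * K (t\<^sup>2)" using that assms t by (intro K) (auto simp: power_mono)
        finally have "\<not> K (t\<^sup>2) \<le> 0" using False
          by (smt (verit) mult_nonneg_nonpos divide_nonneg_nonneg zero_le_power2)
        then show ?thesis using sign[OF t] by linarith
      qed
      have "D u \<le> D x"
      proof (rule DERIV_nonpos_imp_nonincreasing[OF \<open>x \<le> u\<close>])
        fix t assume "x \<le> t" "t \<le> u"
        then show "\<exists>y. (D has_real_derivative y) (at t) \<and> y \<le> 0"
          using deriv[of t] D'_nonpos[of t] assms by (intro exI[of _ "D' t"]) auto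
      qed
      moreover have "1 \<le> sqrt (v u)" by (simp add: v_def)
      moreover have "P u \<le> 1"
        using gauss_lower_plus_upper_1[of u] gauss_upper_nonneg[of u] by (simp add: P_def)
      moreover have "2 * std_normal_density u / u \<le> 1 / u"
      proof -
        have "2 \<le> sqrt (2 * pi)" using pi_ge_two by (intro real_le_rsqrt) simp
        then have "2 * std_normal_density u \<le> exp (- u\<^sup>2 / 2)"
          by (simp add: std_normal_density_def field_simps)
        also have "\<dots> \<le> 1" by simp
        finally show ?thesis using that assms by (intro divide_right_mono) auto
      qed
      ultimately show ?thesis unfolding D_def by linarith
    qed
    have "((\<lambda>u::real. - (1 / u)) \<longlongrightarrow> 0) at_top" by real_asymp
    then show ?thesis
    proof (rule tendsto_upperbound)
      show "\<forall>\<^sub>F u in at_top. - (1 / u) \<le> D x"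
        using eventually_ge_at_top[of x] by eventually_elim (rule up)
    qed simp
  qed
  then have "2 * std_normal_density x + x * P x \<le> x * sqrt (v x)"
    using assms by (simp add: D_def field_simps)
  then show ?thesis unfolding xv[OF assms] P_def .
qed

text \<open>The factors are \<open>a = E max (x - Z) 0\<close> and
  \<open>b = E max (Z - x) 0\<close>, with \<open>a - b = x\<close> and
  \<open>a + b = E \<bar>Z - x\<bar>\<close>. So
  \<open>4 * a * b = (a + b)\<^sup>2 - x\<^sup>2\<close>, and the preceding estimate bounds
  \<open>a + b\<close> for positive \<open>x\<close>; replacing \<open>x\<close> by
  \<open>- x\<close> exchanges the factors.\<close>

lemma gauss_first_moments_prod_le:
  "2 * (std_normal_density x + x * gauss_lower (\<lambda>_. 1) x) * (std_normal_density x - x * gauss_upper (\<lambda>_. 1) x)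
    \<le> sqrt (2 / pi) * std_normal_density x" (is "?l x \<le> ?r x")
proof -
  have r: "?r x = exp (- x\<^sup>2 / 2) / pi" for x
    by (simp add: std_normal_density_def real_sqrt_divide real_sqrt_mult)
  have pos: "?l x \<le> ?r x" if "x > 0" for x
  proof -
    let ?c = "2 * std_normal_density x + x * (2 * gauss_lower (\<lambda>_. 1) x - 1)"
    have "0 \<le> ?c"
    proof -
      have "gauss_upper (\<lambda>_. 1) x \<le> gauss_lower (\<lambda>_. 1) x"
        unfolding gauss_lower_minus[symmetric]
      proof (rule DERIV_nonneg_imp_nondecreasing[where f="gauss_lower (\<lambda>_. 1)"])
        show "\<exists>y. (gauss_lower (\<lambda>_. 1) has_real_derivative y) (at t) \<and> 0 \<le> y" for t
          using gauss_lower_has_derivative[OF gauss_integrable_const[of 1], of t]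
          by (intro exI[of _ "std_normal_density t"]) auto
      qed (use that in simp)
      then have "2 * gauss_lower (\<lambda>_. 1) x - 1 \<ge> 0" using gauss_lower_plus_upper_1[of x] by linarith
      then show ?thesis using that by simp
    qed
    then have "?c\<^sup>2 \<le> (sqrt (x\<^sup>2 + 2 / pi * exp (- x\<^sup>2 / 2)))\<^sup>2"
      using gauss_fold_bound_pos[OF that] by (intro power_mono)
    then have "?c\<^sup>2 \<le> x\<^sup>2 + 2 / pi * exp (- x\<^sup>2 / 2)" by simp
    moreover have "2 * ?l x = ?c\<^sup>2 - x\<^sup>2"
    proof -
      have u: "gauss_upper (\<lambda>_. 1) x = 1 - gauss_lower (\<lambda>_. 1) x" using gauss_lower_plus_upper_1[of x] by linarith
      show ?thesis unfolding u by (simp add: algebra_simps power2_eq_square)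
    qed
    ultimately show ?thesis unfolding r by simp
  qed
  consider "x > 0" | "x = 0" | "-x > 0" by linarith
  then show ?thesis
  proof cases
    case 2
    then show ?thesis unfolding r by (simp add: std_normal_density_def)
  next
    case 3
    from pos[OF this] gauss_lower_minus[of x] gauss_lower_minus[of "-x"] show ?thesis
      by (simp add: std_normal_density_minus algebra_simps)
  qed (rule pos)
qed

section \<open>Stein's equation for Lipschitz functions\<close>

lemma lipschitz1_continuous: "lipschitz1 h \<Longrightarrow> continuous_on S h"
  by (rule lipschitz_on_continuous_on[where L=1], rule lipschitz_onI)
     (auto simp: lipschitz1_def dist_real_def)

lemma gauss_integrable_lipschitz:
  assumes "lipschitz1 h"
  shows "gauss_integrable h"
proof (rule Bochner_Integration.integrable_bound)
  show "integrable lborel (\<lambda>z. std_normal_density z * \<bar>h 0\<bar> + std_normal_density z * \<bar>z\<bar>)"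
    using integrable_std_normal_moment_abs[of 1] gauss_integrable_const
    by (intro Bochner_Integration.integrable_add) auto
  have [measurable]: "h \<in> borel_measurable borel"
    using lipschitz1_continuous[OF assms] by (rule borel_measurable_continuous_onI)
  show "(\<lambda>z. std_normal_density z * h z) \<in> borel_measurable lborel"
    by measurable
  have "\<bar>h z\<bar> \<le> \<bar>h 0\<bar> + \<bar>z\<bar>" for z
    using assms[unfolded lipschitz1_def, rule_format, of z 0] by simp
  then have "std_normal_density z * \<bar>h z\<bar> \<le> std_normal_density z * (\<bar>h 0\<bar> + \<bar>z\<bar>)" for z
    by (intro mult_left_mono) auto
  then show "AE z in lborel. norm (std_normal_density z * h z)
      \<le> norm (std_normal_density z * \<bar>h 0\<bar> + std_normal_density z * \<bar>z\<bar>)"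
    by (auto simp: abs_mult distrib_left)
qed

lemma gauss_lower_scaled_add:
  assumes "gauss_integrable g" "gauss_integrable k"
  shows "gauss_lower (\<lambda>z. g z + c * k z) x = gauss_lower g x + c * gauss_lower k x"
proof -
  have "(\<lambda>z. std_normal_density z * (g z + c * k z)) = (\<lambda>z. std_normal_density z * g z + c * (std_normal_density z * k z))"
    by (auto simp: algebra_simps)
  then show ?thesis
    unfolding gauss_lower_def using assms
    by (simp add: set_integrable_of_integrable)
qed

text \<open>The solution of Stein's equation found with the density as integrating factor. Centering
  \<open>h\<close> makes the lower integral the negative of the upper one, so the quotient can be
  controlled on both tails.\<close>

definition stein_sol :: "(real \<Rightarrow> real) \<Rightarrow> real \<Rightarrow> real" where
  "stein_sol h x = gauss_lower (\<lambda>z. h z - std_normal_mean h) x / std_normal_density x"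

lemma gauss_integrable_centered: "gauss_integrable h \<Longrightarrow> gauss_integrable (\<lambda>z. h z - c)"
  using gauss_integrable_const[of c] by (simp add: right_diff_distrib)

lemma std_normal_mean_centered: "gauss_integrable h \<Longrightarrow> std_normal_mean (\<lambda>z. h z - std_normal_mean h) = 0"
  using gauss_integrable_const[of "std_normal_mean h"] std_normal_mean_const[of "std_normal_mean h"]
  by (simp add: right_diff_distrib)

lemma stein_sol_has_derivative:
  assumes "gauss_integrable h" "continuous_on UNIV h"
  shows "(stein_sol h has_real_derivative x * stein_sol h x + (h x - std_normal_mean h)) (at x)"
proof -
  have "std_normal_density x > 0" by (simp add: normal_density_pos)
  moreover have "continuous_on UNIV (\<lambda>z. h z - std_normal_mean h)"
    by (intro continuous_intros assms)
  ultimately show ?thesis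
    unfolding stein_sol_def
    using gauss_lower_has_derivative[OF gauss_integrable_centered[OF assms(1)], of "std_normal_mean h" x]
    by (auto intro!: derivative_eq_intros simp: field_simps)
qed

text \<open>With \<open>H\<close> the centered \<open>g\<close>, the full integral of
  \<open>H\<close> is 0, so the lower integral may be replaced by minus the upper one. Monotonicity
  compares \<open>H\<close> with the constant \<open>H x\<close> on the upper tail if
  \<open>H x \<ge> 0\<close> and on the lower tail otherwise, and the Mills bound for that tail
  finishes. By Stein's equation the second expression is the derivative of
  \<open>x * stein_sol g x\<close>.\<close>

lemma stein_sol_mono:
  assumes g: "gauss_integrable g" and "mono g"
  shows "stein_sol g x \<le> 0" and "(1 + x\<^sup>2) * stein_sol g x + x * (g x - std_normal_mean g) \<le> 0"
proof -
  define H where "H = (\<lambda>z. g z - std_normal_mean g)"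
  have H: "gauss_integrable H" unfolding H_def by (rule gauss_integrable_centered[OF g])
  have sum0: "gauss_lower H x + gauss_upper H x = 0"
    using gauss_lower_plus_upper[OF H, of x] std_normal_mean_centered[OF g] by (simp add: H_def)
  have pos: "std_normal_density x > 0" by (simp add: normal_density_pos)
  have le: "H y \<le> H z" if "y \<le> z" for y z using \<open>mono g\<close> that by (simp add: H_def monoD)
  have x: "1 + x\<^sup>2 \<ge> 0" by (simp add: add_nonneg_nonneg)
  have "gauss_lower H x \<le> 0 \<and> (1 + x\<^sup>2) * gauss_lower H x + x * H x * std_normal_density x \<le> 0"
  proof (cases "H x \<ge> 0")
    case True
    have "H x * gauss_upper (\<lambda>_. 1) x \<le> gauss_upper H x"
      unfolding gauss_upper_const[of "H x", symmetric]
      by (rule gauss_upper_mono[OF gauss_integrable_const H]) (simp add: le)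
    then have 1: "gauss_lower H x \<le> - (H x * gauss_upper (\<lambda>_. 1) x)" using sum0 by simp
    have "(1 + x\<^sup>2) * gauss_lower H x \<le> (1 + x\<^sup>2) * - (H x * gauss_upper (\<lambda>_. 1) x)"
      using 1 x by (rule mult_left_mono)
    also have "\<dots> = - (H x * ((1 + x\<^sup>2) * gauss_upper (\<lambda>_. 1) x))" by simp
    also have "\<dots> \<le> - (H x * (x * std_normal_density x))"
      using mult_left_mono[OF gauss_upper_mills True] by simp
    finally show ?thesis using 1 True gauss_upper_nonneg[of x]
      by (smt (verit) mult_nonneg_nonneg mult.assoc mult.commute)
  next
    case False
    have 1: "gauss_lower H x \<le> H x * gauss_lower (\<lambda>_. 1) x"
      unfolding gauss_lower_const[of "H x", symmetric]
      by (rule gauss_lower_mono[OF H gauss_integrable_const]) (simp add: le)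
    have "(1 + x\<^sup>2) * gauss_lower H x \<le> (1 + x\<^sup>2) * (H x * gauss_lower (\<lambda>_. 1) x)"
      using 1 x by (rule mult_left_mono)
    also have "\<dots> = H x * ((1 + x\<^sup>2) * gauss_lower (\<lambda>_. 1) x)" by simp
    also have "\<dots> \<le> H x * (- x * std_normal_density x)"
      using False by (intro mult_left_mono_neg gauss_lower_mills) simp
    finally show ?thesis using 1 False gauss_lower_nonneg[of x] mult_nonpos_nonneg[of "H x" "gauss_lower (\<lambda>_. 1) x"]
      by (simp add: mult_ac)
  qed
  then show "stein_sol g x \<le> 0" "(1 + x\<^sup>2) * stein_sol g x + x * (g x - std_normal_mean g) \<le> 0"
    using pos unfolding stein_sol_def H_def[symmetric] H_def[THEN fun_cong, symmetric]
    by (auto simp: divide_le_0_iff) (simp add: field_simps)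
qed

lemma stein_sol_id_add:
  assumes h: "gauss_integrable h"
  shows "stein_sol (\<lambda>z. z + c * h z) x = c * stein_sol h x - 1"
    and "std_normal_mean (\<lambda>z. z + c * h z) = c * std_normal_mean h"
    and "gauss_integrable (\<lambda>z. z + c * h z)"
proof -
  have eq: "(\<lambda>z. std_normal_density z * (z + c * h z)) = (\<lambda>z. std_normal_density z * z + c * (std_normal_density z * h z))"
    by (auto simp: algebra_simps)
  show "gauss_integrable (\<lambda>z. z + c * h z)"
    unfolding eq by (intro Bochner_Integration.integrable_add gauss_integrable_id integrable_mult_right h)
  show m: "std_normal_mean (\<lambda>z. z + c * h z) = c * std_normal_mean h"
    unfolding eq using gauss_integrable_id h std_normal_mean_id by simp
  have "(\<lambda>z. z + c * h z - c * std_normal_mean h) = (\<lambda>z. z + c * (h z - std_normal_mean h))"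
    by (auto simp: algebra_simps)
  then show "stein_sol (\<lambda>z. z + c * h z) x = c * stein_sol h x - 1"
    unfolding stein_sol_def m
    using gauss_lower_scaled_add[OF gauss_integrable_id gauss_integrable_centered[OF h], of c "std_normal_mean h" x]
      normal_density_pos[of 1 0 x]
    by (simp add: gauss_lower_id field_simps)
qed

text \<open>Subtracting \<open>h x\<close> instead of the mean lets the Lipschitz condition act: the
  lower and upper integrals \<open>l\<close>, \<open>u\<close> of \<open>h0\<close> are at most
  \<open>a = d + x * L\<close> and \<open>b = d - x * U\<close> in absolute value. The derivative
  times the density equals \<open>- l * b - u * a\<close>, hence is at most
  \<open>2 * a * b\<close>, which \<open>gauss_first_moments_prod_le\<close> bounds.\<close>

lemma stein_sol_deriv_bound:
  assumes lip: "lipschitz1 h"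
  shows "\<bar>x * stein_sol h x + (h x - std_normal_mean h)\<bar> \<le> sqrt (2 / pi)"
proof -
  have h: "gauss_integrable h" using lip by (rule gauss_integrable_lipschitz)
  define h0 where "h0 = (\<lambda>z. h z - h x)"
  have h0: "gauss_integrable h0" unfolding h0_def by (rule gauss_integrable_centered[OF h])
  define l u L U d where "l = gauss_lower h0 x" and "u = gauss_upper h0 x"
    and "L = gauss_lower (\<lambda>_. 1) x" and "U = gauss_upper (\<lambda>_. 1) x" and "d = std_normal_density x"
  have pos: "d > 0" by (simp add: d_def normal_density_pos)
  have LU: "L + U = 1" using gauss_lower_plus_upper_1 by (simp add: L_def U_def)
  have lu: "l + u = std_normal_mean h - h x"
    using gauss_lower_plus_upper[OF h0, of x] h gauss_integrable_const[of "h x"] std_normal_mean_const[of "h x"]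
    by (simp add: l_def u_def h0_def right_diff_distrib)
  have lip': "\<bar>h0 z\<bar> \<le> \<bar>z - x\<bar>" for z
    using lip by (simp add: h0_def lipschitz1_def)
  have gi: "gauss_integrable (\<lambda>z. z - x)" "gauss_integrable (\<lambda>z. x - z)"
    using gauss_integrable_id gauss_integrable_const[of x] by (simp_all add: right_diff_distrib)
  have low: "gauss_lower (\<lambda>z. x - z) x = d + x * L" "gauss_lower (\<lambda>z. z - x) x = - (d + x * L)"
    using gauss_lower_diff[OF gauss_integrable_const gauss_integrable_id, of x x]
      gauss_lower_diff[OF gauss_integrable_id gauss_integrable_const, of x x]
    by (simp_all add: gauss_lower_id gauss_lower_const[of x] d_def L_def)
  have upp: "gauss_upper (\<lambda>z. z - x) x = d - x * U" "gauss_upper (\<lambda>z. x - z) x = - (d - x * U)"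
    using gauss_upper_diff[OF gauss_integrable_const gauss_integrable_id, of x x]
      gauss_upper_diff[OF gauss_integrable_id gauss_integrable_const, of x x]
    by (simp_all add: gauss_upper_id gauss_upper_const[of x] d_def U_def)
  have l: "\<bar>l\<bar> \<le> d + x * L"
    using gauss_lower_mono[OF h0 gi(2), of x] gauss_lower_mono[OF gi(1) h0, of x] lip' low
    unfolding l_def by (smt (verit))
  have u: "\<bar>u\<bar> \<le> d - x * U"
    using gauss_upper_mono[OF h0 gi(1), of x] gauss_upper_mono[OF gi(2) h0, of x] lip' upp
    unfolding u_def by (smt (verit))
  have "gauss_lower (\<lambda>z. h z - std_normal_mean h) x = l - (l + u) * L"
  proof -
    have "(\<lambda>z. h z - std_normal_mean h) = (\<lambda>z. h0 z - (l + u))" by (simp add: h0_def lu)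
    then show ?thesis
      using gauss_lower_diff[OF h0 gauss_integrable_const[of "l + u"]]
      by (simp add: l_def L_def gauss_lower_const[of "_ + _"])
  qed
  then have st: "stein_sol h x = (l - (l + u) * L) / d" by (simp add: stein_sol_def d_def)
  have hx: "h x - std_normal_mean h = - (l + u)" using lu by linarith
  have "d * (x * stein_sol h x + (h x - std_normal_mean h)) = x * (l - (l + u) * L) - (l + u) * d"
    unfolding st hx using pos by (simp add: field_simps)
  also have "\<dots> = - (l * (d - x * U)) - u * (d + x * L)"
  proof -
    have U: "U = 1 - L" using LU by simp
    show ?thesis unfolding U by (simp add: algebra_simps)
  qed
  also have "\<bar>\<dots>\<bar> \<le> \<bar>l\<bar> * (d - x * U) + \<bar>u\<bar> * (d + x * L)"
    using abs_triangle_ineq4[of "- (l * (d - x * U))" "u * (d + x * L)"] l u by (simp add: abs_mult)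
  also have "\<dots> \<le> (d + x * L) * (d - x * U) + (d - x * U) * (d + x * L)"
    using l u by (intro add_mono mult_right_mono) auto
  also have "\<dots> \<le> sqrt (2 / pi) * d"
    using gauss_first_moments_prod_le[of x] by (simp add: d_def L_def U_def algebra_simps)
  finally have "d * \<bar>x * stein_sol h x + (h x - std_normal_mean h)\<bar> \<le> d * sqrt (2 / pi)"
    using pos by (simp add: abs_mult mult.commute)
  then show ?thesis using pos by simp
qed

text \<open>
  The function \<open>h\<close> is 1-Lipschitz iff \<open>z \<plusminus> h z\<close> are both increasing, and Stein's equation for the
  identity has the solution \<open>-1\<close>; so the sign information for monotone functions becomes
  \<open>\<bar>f x\<bar> \<le> 1\<close> and \<open>\<bar>(x * f x)'\<bar> \<le> 1\<close>, the latter without differentiating \<open>h\<close>.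
\<close>

theorem stein_equation_lipschitz:
  assumes lip: "lipschitz1 h"
  obtains f f' :: "real \<Rightarrow> real"
  where "\<And>x. (f has_real_derivative f' x) (at x)"
    and "\<And>x. f' x - x * f x = h x - std_normal_mean h"
    and "\<And>x. \<bar>f x\<bar> \<le> 1" and "\<And>x. \<bar>f' x\<bar> \<le> sqrt (2 / pi)"
    and "\<And>x y. \<bar>f' x - f' y\<bar> \<le> 2 * \<bar>x - y\<bar>"
proof -
  have h: "gauss_integrable h" using lip by (rule gauss_integrable_lipschitz)
  define f where "f = stein_sol h"
  define H where "H = (\<lambda>x. h x - std_normal_mean h)"
  define f' where "f' = (\<lambda>x. x * f x + H x)"
  have deriv: "(f has_real_derivative f' x) (at x)" for x
    unfolding f_def f'_def H_def using stein_sol_has_derivative[OF h lipschitz1_continuous[OF lip]] .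
  have mono: "mono (\<lambda>z. z + c * h z)" if "\<bar>c\<bar> = 1" for c
  proof (rule monoI)
    fix x y :: real assume "x \<le> y"
    moreover have "\<bar>c * (h x - h y)\<bar> \<le> \<bar>x - y\<bar>"
      using lip that by (simp add: lipschitz1_def abs_mult)
    ultimately show "x + c * h x \<le> y + c * h y" by (simp add: abs_le_iff algebra_simps)
  qed
  have c: "\<bar>1::real\<bar> = 1" "\<bar>- 1::real\<bar> = 1" by simp_all
  have bnd: "\<bar>f x\<bar> \<le> 1" for x
    using stein_sol_mono(1)[OF stein_sol_id_add(3)[OF h] mono[OF c(1)], of x]
      stein_sol_mono(1)[OF stein_sol_id_add(3)[OF h] mono[OF c(2)], of x]
    unfolding stein_sol_id_add(1)[OF h] by (simp add: f_def abs_le_iff)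
  \<comment> \<open>For \<open>c = 1\<close> and \<open>c = -1\<close> the monotone case reads
    \<open>(1 + x\<^sup>2) * (c * f x - 1) + x * (x + c * H x) \<le> 0\<close>; the squares cancel
    and leave the constant 1.\<close>
  have dbnd: "\<bar>(1 + x\<^sup>2) * f x + x * H x\<bar> \<le> 1" for x
    using stein_sol_mono(2)[OF stein_sol_id_add(3)[OF h] mono[OF c(1)], of x]
      stein_sol_mono(2)[OF stein_sol_id_add(3)[OF h] mono[OF c(2)], of x]
    unfolding stein_sol_id_add(1,2)[OF h]
    by (simp add: f_def H_def abs_le_iff algebra_simps power2_eq_square)
  have xf: "\<bar>x * f x - y * f y\<bar> \<le> \<bar>x - y\<bar>" for x y
  proof -
    have "((\<lambda>x. x * f x) has_real_derivative (1 + x\<^sup>2) * f x + x * H x) (at x within UNIV)" for x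
      using deriv[of x] by (auto intro!: derivative_eq_intros simp: f'_def algebra_simps power2_eq_square)
    from field_differentiable_bound[OF convex_UNIV this, of 1 x y] dbnd show ?thesis by simp
  qed
  show ?thesis
  proof (rule that[of f f'])
    show "\<bar>f' x\<bar> \<le> sqrt (2 / pi)" for x
      using stein_sol_deriv_bound[OF lip, of x] by (simp add: f'_def f_def H_def)
    \<comment> \<open>\<open>f'\<close> is the sum of \<open>x * f x\<close> and \<open>H\<close>,
      each with Lipschitz constant 1.\<close>
    show "\<bar>f' x - f' y\<bar> \<le> 2 * \<bar>x - y\<bar>" for x y
      using xf[of x y] lip[unfolded lipschitz1_def, rule_format, of x y]
        abs_triangle_ineq[of "x * f x - y * f y" "h x - h y"]
      by (simp add: f'_def H_def algebra_simps)
  qed (use deriv bnd in \<open>auto simp: f'_def H_def\<close>)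
qed

section \<open>Second-order Taylor expansion with a Lipschitz second derivative\<close>

lemma abs_le_power_of_deriv:
  fixes r r' :: "real \<Rightarrow> real"
  assumes deriv: "\<And>t. (r has_real_derivative r' t) (at t)" and "r x = 0"
    and bound: "\<And>t. \<bar>r' t\<bar> \<le> C * real (Suc n) * \<bar>t - x\<bar> ^ n"
  shows "\<bar>r y\<bar> \<le> C * \<bar>y - x\<bar> ^ Suc n"
proof -
  \<comment> \<open>To the right of \<open>x\<close>, \<open>s\<close> is compared with
    \<open>C * (t - x) ^ Suc n\<close>, whose derivative is the assumed bound on
    \<open>s'\<close>.\<close>
  have right: "s y \<le> C * (y - x) ^ Suc n"
    if "\<And>t. (s has_real_derivative s' t) (at t)" "s x = 0"
      "\<And>t. s' t \<le> C * real (Suc n) * \<bar>t - x\<bar> ^ n" "x \<le> y" for s s' and y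
  proof -
    have "C * (x - x) ^ Suc n - s x \<le> C * (y - x) ^ Suc n - s y"
    proof (rule DERIV_nonneg_imp_nondecreasing[OF \<open>x \<le> y\<close>, where f="\<lambda>t. C * (t - x) ^ Suc n - s t"])
      fix t assume "x \<le> t"
      have "((\<lambda>t. C * (t - x) ^ Suc n - s t) has_real_derivative C * real (Suc n) * (t - x) ^ n - s' t) (at t)"
        using that(1)[of t] by (auto intro!: derivative_eq_intros simp del: power_Suc)
      moreover have "C * real (Suc n) * (t - x) ^ n - s' t \<ge> 0" using that(3)[of t] \<open>x \<le> t\<close> by simp
      ultimately show "\<exists>d. ((\<lambda>t. C * (t - x) ^ Suc n - s t) has_real_derivative d) (at t) \<and> 0 \<le> d"
        by blast
    qed
    then show ?thesis using that(2) by simp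
  qed
  have both: "\<bar>s y\<bar> \<le> C * (y - x) ^ Suc n"
    if d: "\<And>t. (s has_real_derivative s' t) (at t)" and "s x = 0"
      and b: "\<And>t. \<bar>s' t\<bar> \<le> C * real (Suc n) * \<bar>t - x\<bar> ^ n" and "x \<le> y" for s s' and y
  proof -
    have "s y \<le> C * (y - x) ^ Suc n"
      using d \<open>s x = 0\<close> abs_le_D1[OF b] \<open>x \<le> y\<close> by (rule right)
    moreover have "- s y \<le> C * (y - x) ^ Suc n"
      by (rule right[where s="\<lambda>t. - s t", OF DERIV_minus[OF d] _ abs_le_D2[OF b] \<open>x \<le> y\<close>]) (simp add: \<open>s x = 0\<close>)
    ultimately show ?thesis by simp
  qed
  show ?thesis
  proof (cases "x \<le> y")
    case True
    then show ?thesis using both[OF deriv \<open>r x = 0\<close> bound True] by simp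
  next
    case False
    \<comment> \<open>Reflection at \<open>x\<close> carries a point on the left to one on the
      right.\<close>
    have "\<bar>r (2 * x - (2 * x - y))\<bar> \<le> C * ((2 * x - y) - x) ^ Suc n"
    proof (rule both[where s="\<lambda>t. r (2 * x - t)" and s'="\<lambda>t. - r' (2 * x - t)"])
      show "((\<lambda>t. r (2 * x - t)) has_real_derivative - r' (2 * x - t)) (at t)" for t
      proof -
        have "((\<lambda>t. 2 * x - t) has_real_derivative - 1) (at t)"
          by (auto intro!: derivative_eq_intros)
        from DERIV_chain2[where f=r, OF deriv this] show ?thesis by simp
      qed
      show "\<bar>- r' (2 * x - t)\<bar> \<le> C * real (Suc n) * \<bar>t - x\<bar> ^ n" for t
        using bound[of "2 * x - t"] by (simp add: abs_minus_commute)
    qed (use False \<open>r x = 0\<close> in auto)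
    then show ?thesis using False by simp
  qed
qed

text \<open>The Lipschitz bound is integrated twice: \<open>2 * \<bar>t - x\<bar>\<close> becomes
  \<open>\<bar>t - x\<bar>\<^sup>2\<close> for \<open>f\<close> and then a third of the cube for
  \<open>G\<close>. No derivative of \<open>f'\<close> is required, which matters because
  \<open>h\<close> is merely Lipschitz.\<close>

lemma taylor2_lipschitz:
  fixes f f' G :: "real \<Rightarrow> real"
  assumes f: "\<And>x. (f has_real_derivative f' x) (at x)" and G: "\<And>x. (G has_real_derivative f x) (at x)"
    and lip: "\<And>x y. \<bar>f' x - f' y\<bar> \<le> 2 * \<bar>x - y\<bar>"
  shows "\<bar>G y - G x - f x * (y - x) - f' x * (y - x)\<^sup>2 / 2\<bar> \<le> \<bar>y - x\<bar> ^ 3 / 3"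
proof -
  have 1: "\<bar>f t - f x - f' x * (t - x)\<bar> \<le> 1 * \<bar>t - x\<bar> ^ Suc 1" for t
    by (rule abs_le_power_of_deriv[where r'="\<lambda>t. f' t - f' x"])
       (use f lip in \<open>auto intro!: derivative_eq_intros\<close>)
  have "\<bar>G y - G x - f x * (y - x) - f' x * (y - x)\<^sup>2 / 2\<bar> \<le> 1 / 3 * \<bar>y - x\<bar> ^ Suc 2"
    by (rule abs_le_power_of_deriv[where r'="\<lambda>t. f t - f x - f' x * (t - x)"])
       (use G 1 in \<open>auto intro!: derivative_eq_intros simp: power2_eq_square\<close>)
  then show ?thesis by (simp add: numeral_3_eq_3)
qed

lemma continuous_antiderivative:
  fixes f :: "real \<Rightarrow> real"
  assumes "continuous_on UNIV f"
  obtains G where "\<And>x. (G has_real_derivative f x) (at x)"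
  using einterval_antiderivative[of "-\<infinity>" "\<infinity>" f] assms
  by (auto simp: continuous_on_eq_continuous_at has_real_derivative_iff_has_vector_derivative)

section \<open>Conditional moments given \<open>(W, Y)\<close>\<close>

lemma subalgebra_sigma_WY:
  assumes [measurable]: "W \<in> borel_measurable M" "Y \<in> borel_measurable M"
  shows "subalgebra M (sigma_WY M W Y)"
  unfolding subalgebra_def sigma_WY_def
  by (intro conjI sets_image_in_sets space_vimage_algebra refl) measurable

lemma measurable_sigma_WY:
  assumes "u \<in> borel_measurable (borel \<Otimes>\<^sub>M borel)"
  shows "(\<lambda>\<omega>. u (W \<omega>, Y \<omega>)) \<in> borel_measurable (sigma_WY M W Y)"
proof -
  have "(\<lambda>\<omega>. (W \<omega>, Y \<omega>)) \<in> measurable (sigma_WY M W Y) borel"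
    unfolding sigma_WY_def by (rule measurable_vimage_algebra1) simp
  from measurable_compose[OF this] assms show ?thesis by (simp add: borel_prod)
qed

lemma integrable_bounded_mult:
  fixes u g :: "'a \<Rightarrow> real"
  assumes "integrable M g" "u \<in> borel_measurable M" "\<And>x. \<bar>u x\<bar> \<le> b"
  shows "integrable M (\<lambda>x. u x * g x)"
proof (rule Bochner_Integration.integrable_bound)
  show "integrable M (\<lambda>x. b * g x)" using assms(1) by (rule integrable_mult_right)
  have "\<bar>u x\<bar> * \<bar>g x\<bar> \<le> \<bar>b\<bar> * \<bar>g x\<bar>" for x
    using assms(3)[of x] by (intro mult_right_mono) auto
  then show "AE x in M. norm (u x * g x) \<le> norm (b * g x)"
    by (simp add: abs_mult)
qed (use assms in measurable)

lemma abs_integral_le_integral: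
  fixes u g :: "'a \<Rightarrow> real"
  assumes "integrable M u" "integrable M g" "\<And>x. \<bar>u x\<bar> \<le> g x"
  shows "\<bar>\<integral>x. u x \<partial>M\<bar> \<le> (\<integral>x. g x \<partial>M)"
  using integral_abs_bound[of M u] integral_mono[OF integrable_abs[OF assms(1)] assms(2)] assms(3)
  by (meson order_trans)

text \<open>The weight \<open>of_bool (Y \<omega> = j) * v (W \<omega>)\<close> is a bounded
  function of \<open>(W, Y)\<close> and so passes through the conditional expectation. In this
  tested form conditions (III) and (IV) become plain integral identities, and the Stein argument
  itself can do without conditional expectations.\<close>

lemma (in prob_space) Mcond_integral:
  fixes v :: "real \<Rightarrow> real"
  assumes [measurable]: "W \<in> borel_measurable M" "Y \<in> borel_measurable M"
      "W' \<in> borel_measurable M" "Y' \<in> borel_measurable M"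
    and int: "integrable M (\<lambda>\<omega>. (W' \<omega> - W \<omega>) ^ l)"
    and [measurable]: "v \<in> borel_measurable borel" and bound: "\<And>x. \<bar>v x\<bar> \<le> b"
  shows "integrable M (Mcond M W Y W' Y' l s)"
    and "(\<integral>\<omega>. of_bool (Y \<omega> = j) * v (W \<omega>) * Mcond M W Y W' Y' l s \<omega> \<partial>M)
      = (\<integral>\<omega>. of_bool (Y \<omega> = j) * v (W \<omega>) * (of_bool (Y' \<omega> - Y \<omega> = s) * (W' \<omega> - W \<omega>) ^ l) \<partial>M)"
proof -
  interpret F: finite_measure_subalgebra M "sigma_WY M W Y"
    by unfold_locales (intro subalgebra_sigma_WY; measurable)
  let ?g = "\<lambda>\<omega>. (W' \<omega> - W \<omega>) ^ l * (if Y' \<omega> - Y \<omega> = s then 1 else 0)"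
  have g: "integrable M ?g"
    by (rule Bochner_Integration.integrable_bound[OF int]) auto
  then show "integrable M (Mcond M W Y W' Y' l s)"
    unfolding Mcond_def by (rule F.real_cond_exp_int)
  have "(\<integral>\<omega>. of_bool (Y \<omega> = j) * v (W \<omega>) * Mcond M W Y W' Y' l s \<omega> \<partial>M)
      = (\<integral>\<omega>. of_bool (Y \<omega> = j) * v (W \<omega>) * ?g \<omega> \<partial>M)"
    unfolding Mcond_def
  proof (rule F.real_cond_exp_intg(2))
    have "\<bar>of_bool P * v w\<bar> \<le> b" for P w using bound[of w] by (cases P) auto
    then show "integrable M (\<lambda>\<omega>. of_bool (Y \<omega> = j) * v (W \<omega>) * ?g \<omega>)"
      by (intro integrable_bounded_mult[OF g, where b=b]) auto
    have "(\<lambda>p. of_bool (snd p = j) * v (fst p)) \<in> borel_measurable (borel \<Otimes>\<^sub>M borel)" by measurable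
    from measurable_sigma_WY[OF this] show "(\<lambda>\<omega>. of_bool (Y \<omega> = j) * v (W \<omega>)) \<in> borel_measurable (sigma_WY M W Y)"
      by simp
  qed measurable
  also have "\<dots> = (\<integral>\<omega>. of_bool (Y \<omega> = j) * v (W \<omega>) * (of_bool (Y' \<omega> - Y \<omega> = s) * (W' \<omega> - W \<omega>) ^ l) \<partial>M)"
    by (intro Bochner_Integration.integral_cong) auto
  finally show "(\<integral>\<omega>. of_bool (Y \<omega> = j) * v (W \<omega>) * Mcond M W Y W' Y' l s \<omega> \<partial>M)
      = (\<integral>\<omega>. of_bool (Y \<omega> = j) * v (W \<omega>) * (of_bool (Y' \<omega> - Y \<omega> = s) * (W' \<omega> - W \<omega>) ^ l) \<partial>M)" .
qed

section \<open>Conditional Stein method for exchangeable pairs\<close>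

lemma integral_exchangeable:
  fixes W Y W' Y' :: "'a \<Rightarrow> real" and F :: "real \<times> real \<times> real \<times> real \<Rightarrow> real"
  assumes [measurable]: "W \<in> borel_measurable M" "Y \<in> borel_measurable M"
      "W' \<in> borel_measurable M" "Y' \<in> borel_measurable M"
    and exch: "distr M borel (\<lambda>\<omega>. (W \<omega>, Y \<omega>, W' \<omega>, Y' \<omega>)) = distr M borel (\<lambda>\<omega>. (W' \<omega>, Y' \<omega>, W \<omega>, Y \<omega>))"
    and F: "F \<in> borel_measurable borel"
  shows "(\<integral>\<omega>. F (W \<omega>, Y \<omega>, W' \<omega>, Y' \<omega>) \<partial>M) = (\<integral>\<omega>. F (W' \<omega>, Y' \<omega>, W \<omega>, Y \<omega>) \<partial>M)"
    and "integrable M (\<lambda>\<omega>. F (W \<omega>, Y \<omega>, W' \<omega>, Y' \<omega>)) \<longleftrightarrow> integrable M (\<lambda>\<omega>. F (W' \<omega>, Y' \<omega>, W \<omega>, Y \<omega>))"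
proof -
  have m: "(\<lambda>\<omega>. (W \<omega>, Y \<omega>, W' \<omega>, Y' \<omega>)) \<in> measurable M borel"
    "(\<lambda>\<omega>. (W' \<omega>, Y' \<omega>, W \<omega>, Y \<omega>)) \<in> measurable M borel"
    by measurable
  show "(\<integral>\<omega>. F (W \<omega>, Y \<omega>, W' \<omega>, Y' \<omega>) \<partial>M) = (\<integral>\<omega>. F (W' \<omega>, Y' \<omega>, W \<omega>, Y \<omega>) \<partial>M)"
    using integral_distr[OF m(1) F] integral_distr[OF m(2) F] by (simp add: exch)
  show "integrable M (\<lambda>\<omega>. F (W \<omega>, Y \<omega>, W' \<omega>, Y' \<omega>)) \<longleftrightarrow> integrable M (\<lambda>\<omega>. F (W' \<omega>, Y' \<omega>, W \<omega>, Y \<omega>))"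
    using integrable_distr_eq[OF m(1) F] integrable_distr_eq[OF m(2) F] by (simp add: exch)
qed

lemma (in prob_space) integrable_power_le_3:
  fixes X :: "'a \<Rightarrow> real"
  assumes [measurable]: "X \<in> borel_measurable M" and int: "integrable M (\<lambda>\<omega>. \<bar>X \<omega>\<bar> ^ 3)" and "l \<le> 3"
  shows "integrable M (\<lambda>\<omega>. X \<omega> ^ l)"
proof (rule Bochner_Integration.integrable_bound[where f="\<lambda>\<omega>. 1 + \<bar>X \<omega>\<bar> ^ 3"])
  have "\<bar>x\<bar> ^ l \<le> 1 + \<bar>x\<bar> ^ 3" for x :: real
  proof (cases "\<bar>x\<bar> \<le> 1")
    case True
    then show ?thesis using power_le_one[of "\<bar>x\<bar>" l] zero_le_power[of "\<bar>x\<bar>" 3] by linarith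
  next
    case False
    then show ?thesis using power_increasing[OF \<open>l \<le> 3\<close>, of "\<bar>x\<bar>"] by linarith
  qed
  then show "AE \<omega> in M. norm (X \<omega> ^ l) \<le> norm (1 + \<bar>X \<omega>\<bar> ^ 3)"
    by (auto simp: power_abs)
qed (use int in auto)

text \<open>The first argument of \<open>R1\<close> and \<open>R2\<close> is the sign \<open>s = \<plusminus>1\<close> of the step of \<open>Y\<close>.\<close>

locale stein_pair = prob_space M for M :: "'a measure" +
  fixes W Y W' Y' :: "'a \<Rightarrow> real" and R1 R2 :: "real \<Rightarrow> 'a \<Rightarrow> real" and lam psi :: real
  assumes meas [measurable]: "W \<in> borel_measurable M" "Y \<in> borel_measurable M"
      "W' \<in> borel_measurable M" "Y' \<in> borel_measurable M"
    and R_int: "\<And>s. s \<in> {1, -1} \<Longrightarrow> integrable M (R1 s)" "\<And>s. s \<in> {1, -1} \<Longrightarrow> integrable M (R2 s)"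
    and W_int: "integrable M W" and step_int: "integrable M (\<lambda>\<omega>. \<bar>W' \<omega> - W \<omega>\<bar> ^ 3)"
    and exch: "distr M borel (\<lambda>\<omega>. (W \<omega>, Y \<omega>, W' \<omega>, Y' \<omega>)) = distr M borel (\<lambda>\<omega>. (W' \<omega>, Y' \<omega>, W \<omega>, Y \<omega>))"
    and pos: "0 < lam" "0 < psi"
    and moment1: "\<And>s v b j. \<lbrakk>s \<in> {1, -1}; v \<in> borel_measurable borel; \<And>x. \<bar>v x\<bar> \<le> b\<rbrakk> \<Longrightarrow>
      (\<integral>\<omega>. of_bool (Y \<omega> = j) * v (W \<omega>) * (of_bool (Y' \<omega> - Y \<omega> = s) * (W' \<omega> - W \<omega>)) \<partial>M)
      = (\<integral>\<omega>. of_bool (Y \<omega> = j) * v (W \<omega>) * (- lam * (psi * W \<omega> / 2 + R1 s \<omega>)) \<partial>M)"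
    and moment2: "\<And>s v b j. \<lbrakk>s \<in> {1, -1}; v \<in> borel_measurable borel; \<And>x. \<bar>v x\<bar> \<le> b\<rbrakk> \<Longrightarrow>
      (\<integral>\<omega>. of_bool (Y \<omega> = j) * v (W \<omega>) * (of_bool (Y' \<omega> - Y \<omega> = s) * (W' \<omega> - W \<omega>)\<^sup>2) \<partial>M)
      = (\<integral>\<omega>. of_bool (Y \<omega> = j) * v (W \<omega>) * (lam * (psi + R2 s \<omega>)) \<partial>M)"
begin

lemma R_meas [measurable]: "R1 1 \<in> borel_measurable M" "R1 (-1) \<in> borel_measurable M"
    "R2 1 \<in> borel_measurable M" "R2 (-1) \<in> borel_measurable M"
  using R_int[of 1] R_int[of "-1"] by auto

lemma step_power_int: "l \<le> 3 \<Longrightarrow> integrable M (\<lambda>\<omega>. (W' \<omega> - W \<omega>) ^ l)"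
  by (rule integrable_power_le_3[OF _ step_int]) measurable

section \<open>Transport of \<open>G\<close> between neighbouring levels of \<open>Y\<close>\<close>

context
  fixes f f' G :: "real \<Rightarrow> real" and q :: real
  assumes f: "\<And>x. (f has_real_derivative f' x) (at x)" and G: "\<And>x. (G has_real_derivative f x) (at x)"
    and f_le: "\<And>x. \<bar>f x\<bar> \<le> 1" and f'_le: "\<And>x. \<bar>f' x\<bar> \<le> q"
    and f'_lip: "\<And>x y. \<bar>f' x - f' y\<bar> \<le> 2 * \<bar>x - y\<bar>"
begin

text \<open>\<open>flow j (-1)\<close> and \<open>flow j 1\<close> are the \<open>a j\<close> and
  \<open>b j\<close> of the overview.\<close>

definition flow :: "real \<Rightarrow> real \<Rightarrow> real" where
  "flow j s = (\<integral>\<omega>. of_bool (Y \<omega> = j) * of_bool (Y' \<omega> - Y \<omega> = s) * (G (W' \<omega>) - G (W \<omega>)) \<partial>M)"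

text \<open>The first two Taylor terms of the increment of \<open>G\<close> after the conditional
  moments have been replaced by (III) and (IV). The part with \<open>psi\<close> is the Stein
  operator and is the same for both signs, so it cancels in
  \<open>drift 1 \<omega> - drift (-1) \<omega>\<close>.\<close>

definition drift :: "real \<Rightarrow> 'a \<Rightarrow> real" where
  "drift s \<omega> = lam * (psi / 2 * (f' (W \<omega>) - W \<omega> * f (W \<omega>)) - R1 s \<omega> * f (W \<omega>) + R2 s \<omega> * f' (W \<omega>) / 2)"

lemma f_meas [measurable]: "f \<in> borel_measurable borel" "f' \<in> borel_measurable borel" "G \<in> borel_measurable borel"
proof -
  have "continuous_on UNIV f" "continuous_on UNIV G"
    using f G by (auto intro!: DERIV_continuous_on)
  moreover have "continuous_on UNIV f'"
    by (rule lipschitz_on_continuous_on[where L=2], rule lipschitz_onI)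
       (use f'_lip in \<open>auto simp: dist_real_def\<close>)
  ultimately show "f \<in> borel_measurable borel" "f' \<in> borel_measurable borel" "G \<in> borel_measurable borel"
    by (auto intro: borel_measurable_continuous_onI)
qed

lemma G_lip: "\<bar>G x - G y\<bar> \<le> \<bar>x - y\<bar>"
  using field_differentiable_bound[OF convex_UNIV, of G f 1 x y] G f_le by auto

lemma G_step_int: "integrable M (\<lambda>\<omega>. G (W' \<omega>) - G (W \<omega>))"
  by (rule Bochner_Integration.integrable_bound[OF step_power_int[of 1]]) (use G_lip in auto)

lemma G_taylor: "\<bar>G y - G x - f x * (y - x) - f' x * (y - x)\<^sup>2 / 2\<bar> \<le> \<bar>y - x\<bar> ^ 3 / 3"
  using f G f'_lip by (rule taylor2_lipschitz)

lemma f_mult_int: "integrable M g \<Longrightarrow> integrable M (\<lambda>\<omega>. f (W \<omega>) * g \<omega>)"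
  by (rule integrable_bounded_mult[where b=1]) (auto simp: f_le)

lemma f'_mult_int: "integrable M g \<Longrightarrow> integrable M (\<lambda>\<omega>. f' (W \<omega>) * g \<omega>)"
  by (rule integrable_bounded_mult[where b=q]) (auto simp: f'_le)

lemma drift_int: "s \<in> {1, -1} \<Longrightarrow> integrable M (drift s)"
proof -
  assume s: "s \<in> {1, -1}"
  have "integrable M (\<lambda>\<omega>. f' (W \<omega>) * 1)" "integrable M (\<lambda>\<omega>. f (W \<omega>) * W \<omega>)"
    "integrable M (\<lambda>\<omega>. f (W \<omega>) * R1 s \<omega>)" "integrable M (\<lambda>\<omega>. f' (W \<omega>) * R2 s \<omega>)"
    using W_int R_int[OF s] f'_mult_int[of "\<lambda>_. 1"] by (auto intro: f_mult_int f'_mult_int)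
  then show ?thesis unfolding drift_def by (auto simp: mult.commute)
qed

text \<open>\<open>moment1\<close> tested with \<open>f\<close> and \<open>moment2\<close> tested
  with \<open>f'\<close> turn the first two Taylor terms into \<open>drift\<close>; what is left is
  exactly the Taylor remainder.\<close>

lemma flow_drift:
  assumes s: "s \<in> {1, -1}"
  shows "flow j s - (\<integral>\<omega>. of_bool (Y \<omega> = j) * drift s \<omega> \<partial>M)
    = (\<integral>\<omega>. of_bool (Y \<omega> = j) * (of_bool (Y' \<omega> - Y \<omega> = s) *
        (G (W' \<omega>) - G (W \<omega>) - f (W \<omega>) * (W' \<omega> - W \<omega>) - f' (W \<omega>) * (W' \<omega> - W \<omega>)\<^sup>2 / 2)) \<partial>M)"
proof -
  let ?c = "\<lambda>\<omega>. of_bool (Y \<omega> = j) :: real" and ?d = "\<lambda>\<omega>. of_bool (Y' \<omega> - Y \<omega> = s) :: real"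
  let ?D = "\<lambda>\<omega>. W' \<omega> - W \<omega>"
  have b1: "\<bar>of_bool P * f x\<bar> \<le> 1" and b2: "\<bar>of_bool P * f' x\<bar> \<le> q" for P x
    using f_le[of x] f'_le[of x] by (cases P; auto)+
  have 1: "(\<integral>\<omega>. ?c \<omega> * f (W \<omega>) * (?d \<omega> * ?D \<omega>) \<partial>M)
      = (\<integral>\<omega>. ?c \<omega> * f (W \<omega>) * (- lam * (psi * W \<omega> / 2 + R1 s \<omega>)) \<partial>M)"
    by (rule moment1[OF s _ f_le]) measurable
  have 2: "(\<integral>\<omega>. ?c \<omega> * f' (W \<omega>) * (?d \<omega> * (?D \<omega>)\<^sup>2) \<partial>M)
      = (\<integral>\<omega>. ?c \<omega> * f' (W \<omega>) * (lam * (psi + R2 s \<omega>)) \<partial>M)"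
    by (rule moment2[OF s _ f'_le]) measurable
  have d1: "integrable M (\<lambda>\<omega>. ?d \<omega> * ?D \<omega>)" "integrable M (\<lambda>\<omega>. ?d \<omega> * (?D \<omega>)\<^sup>2)"
    using step_power_int[of 1] step_power_int[of 2] by (auto intro!: integrable_bounded_mult[where b=1])
  have i1: "integrable M (\<lambda>\<omega>. ?c \<omega> * f (W \<omega>) * (?d \<omega> * ?D \<omega>))"
    by (intro integrable_bounded_mult[OF d1(1), where b=1] b1) measurable
  have i2: "integrable M (\<lambda>\<omega>. ?c \<omega> * f' (W \<omega>) * (?d \<omega> * (?D \<omega>)\<^sup>2))"
    by (intro integrable_bounded_mult[OF d1(2), where b=q] b2) measurable
  have i3: "integrable M (\<lambda>\<omega>. ?c \<omega> * f (W \<omega>) * (- lam * (psi * W \<omega> / 2 + R1 s \<omega>)))"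
    using W_int R_int[OF s]
    by (intro integrable_bounded_mult[where b=1 and g="\<lambda>\<omega>. - lam * (psi * W \<omega> / 2 + R1 s \<omega>)"] b1) auto
  have i4: "integrable M (\<lambda>\<omega>. ?c \<omega> * f' (W \<omega>) * (lam * (psi + R2 s \<omega>)))"
    using R_int[OF s]
    by (intro integrable_bounded_mult[where b=q and g="\<lambda>\<omega>. lam * (psi + R2 s \<omega>)"] b2) auto
  have i5: "integrable M (\<lambda>\<omega>. ?c \<omega> * ?d \<omega> * (G (W' \<omega>) - G (W \<omega>)))"
    using G_step_int by (intro integrable_bounded_mult[where b=1]) auto
  have "(\<integral>\<omega>. ?c \<omega> * drift s \<omega> \<partial>M)
      = (\<integral>\<omega>. ?c \<omega> * f (W \<omega>) * (- lam * (psi * W \<omega> / 2 + R1 s \<omega>)) + ?c \<omega> * f' (W \<omega>) * (lam * (psi + R2 s \<omega>)) / 2 \<partial>M)"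
    by (intro Bochner_Integration.integral_cong refl) (simp add: drift_def field_simps)
  also have "\<dots> = (\<integral>\<omega>. ?c \<omega> * f (W \<omega>) * (?d \<omega> * ?D \<omega>) \<partial>M) + (\<integral>\<omega>. ?c \<omega> * f' (W \<omega>) * (?d \<omega> * (?D \<omega>)\<^sup>2) \<partial>M) / 2"
    unfolding 1 2 using i3 i4 by (subst Bochner_Integration.integral_add) auto
  finally have "flow j s - (\<integral>\<omega>. ?c \<omega> * drift s \<omega> \<partial>M) = (\<integral>\<omega>. ?c \<omega> * ?d \<omega> * (G (W' \<omega>) - G (W \<omega>)) \<partial>M)
      - (\<integral>\<omega>. ?c \<omega> * f (W \<omega>) * (?d \<omega> * ?D \<omega>) \<partial>M) - (\<integral>\<omega>. ?c \<omega> * f' (W \<omega>) * (?d \<omega> * (?D \<omega>)\<^sup>2) \<partial>M) / 2"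
    by (simp add: flow_def)
  also have "\<dots> = (\<integral>\<omega>. ?c \<omega> * ?d \<omega> * (G (W' \<omega>) - G (W \<omega>)) - ?c \<omega> * f (W \<omega>) * (?d \<omega> * ?D \<omega>)
      - ?c \<omega> * f' (W \<omega>) * (?d \<omega> * (?D \<omega>)\<^sup>2) / 2 \<partial>M)"
    using i1 i2 i5 by simp
  also have "\<dots> = (\<integral>\<omega>. ?c \<omega> * (?d \<omega> *
        (G (W' \<omega>) - G (W \<omega>) - f (W \<omega>) * ?D \<omega> - f' (W \<omega>) * (?D \<omega>)\<^sup>2 / 2)) \<partial>M)"
    by (intro Bochner_Integration.integral_cong refl) (simp add: algebra_simps)
  finally show ?thesis .
qed

lemma rem_int: "integrable M (\<lambda>\<omega>. G (W' \<omega>) - G (W \<omega>) - f (W \<omega>) * (W' \<omega> - W \<omega>) - f' (W \<omega>) * (W' \<omega> - W \<omega>)\<^sup>2 / 2)"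
proof (rule Bochner_Integration.integrable_bound[OF integrable_divide[OF step_int, of 3]])
  show "AE \<omega> in M. norm (G (W' \<omega>) - G (W \<omega>) - f (W \<omega>) * (W' \<omega> - W \<omega>) - f' (W \<omega>) * (W' \<omega> - W \<omega>)\<^sup>2 / 2)
      \<le> norm (\<bar>W' \<omega> - W \<omega>\<bar> ^ 3 / 3)"
    using G_taylor by simp
qed measurable

text \<open>A pointwise bound for the mismatch between steps up and steps down that does not depend
  on the level \<open>j\<close>, so that sums over levels become integrals over unions of
  levels.\<close>

definition defect :: "'a \<Rightarrow> real" where
  "defect \<omega> = lam * \<bar>R1 1 \<omega> - R1 (-1) \<omega>\<bar> + lam * q / 2 * \<bar>R2 1 \<omega> - R2 (-1) \<omega>\<bar> + \<bar>W' \<omega> - W \<omega>\<bar> ^ 3 / 3"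

lemma defect_int: "integrable M defect"
  unfolding defect_def using R_int step_int by auto

lemma q_nonneg: "q \<ge> 0" using f'_le[of 0] by linarith

lemma defect_nonneg: "defect \<omega> \<ge> 0"
  unfolding defect_def using pos q_nonneg by (intro add_nonneg_nonneg) auto

text \<open>The swap turns a step down from \<open>j\<close> into a step up from
  \<open>j - 1\<close> and reverses the sign of the increment of \<open>G\<close>.\<close>

lemma flow_backward: "flow j (-1) = - flow (j - 1) 1"
proof -
  define F :: "real \<times> real \<times> real \<times> real \<Rightarrow> real" where
    "F = (\<lambda>(w, y, w', y'). of_bool (y = j) * of_bool (y' - y = -1) * (G w' - G w))"
  have F: "F \<in> borel_measurable borel"
    unfolding F_def borel_prod[symmetric] by measurable
  have "flow j (-1) = (\<integral>\<omega>. F (W' \<omega>, Y' \<omega>, W \<omega>, Y \<omega>) \<partial>M)"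
    using integral_exchangeable(1)[OF meas exch F] by (simp add: flow_def F_def)
  also have "\<dots> = (\<integral>\<omega>. - (of_bool (Y \<omega> = j - 1) * of_bool (Y' \<omega> - Y \<omega> = 1) * (G (W' \<omega>) - G (W \<omega>))) \<partial>M)"
    by (intro Bochner_Integration.integral_cong refl) (auto simp: F_def)
  finally show ?thesis by (simp add: flow_def)
qed

lemma flow_diff: "\<bar>flow j 1 - flow j (-1)\<bar> \<le> (\<integral>\<omega>. of_bool (Y \<omega> = j) * defect \<omega> \<partial>M)"
proof -
  let ?c = "\<lambda>\<omega>. of_bool (Y \<omega> = j) :: real" and ?d = "\<lambda>s \<omega>. of_bool (Y' \<omega> - Y \<omega> = s) :: real"
  let ?r = "\<lambda>\<omega>. G (W' \<omega>) - G (W \<omega>) - f (W \<omega>) * (W' \<omega> - W \<omega>) - f' (W \<omega>) * (W' \<omega> - W \<omega>)\<^sup>2 / 2"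
  have i1: "integrable M (\<lambda>\<omega>. ?c \<omega> * drift s \<omega>)" if "s \<in> {1, -1}" for s
    using drift_int[OF that] by (intro integrable_bounded_mult[where b=1]) auto
  have i2: "integrable M (\<lambda>\<omega>. ?c \<omega> * (?d s \<omega> * ?r \<omega>))" for s
    using rem_int by (intro integrable_bounded_mult[where b=1]) auto
  have i3: "integrable M (\<lambda>\<omega>. ?c \<omega> * defect \<omega>)"
    using defect_int by (intro integrable_bounded_mult[where b=1]) auto
  have "flow j 1 - flow j (-1) = (\<integral>\<omega>. ?c \<omega> * drift 1 \<omega> \<partial>M) + (\<integral>\<omega>. ?c \<omega> * (?d 1 \<omega> * ?r \<omega>) \<partial>M)
      - ((\<integral>\<omega>. ?c \<omega> * drift (-1) \<omega> \<partial>M) + (\<integral>\<omega>. ?c \<omega> * (?d (-1) \<omega> * ?r \<omega>) \<partial>M))"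
    using flow_drift[of 1 j] flow_drift[of "-1" j] by simp
  also have "\<dots> = (\<integral>\<omega>. ?c \<omega> * drift 1 \<omega> + ?c \<omega> * (?d 1 \<omega> * ?r \<omega>)
      - (?c \<omega> * drift (-1) \<omega> + ?c \<omega> * (?d (-1) \<omega> * ?r \<omega>)) \<partial>M)"
    using i1[of 1] i1[of "-1"] i2 by simp
  finally have eq: "flow j 1 - flow j (-1) = \<dots>" .
  show ?thesis
    unfolding eq
  proof (rule abs_integral_le_integral)
    fix \<omega>
    \<comment> \<open>The events \<open>Y' - Y = 1\<close> and \<open>Y' - Y = -1\<close> exclude
      each other, so the remainder counts once, not twice.\<close>
    have 1: "\<bar>(?d 1 \<omega> - ?d (-1) \<omega>) * ?r \<omega>\<bar> \<le> \<bar>W' \<omega> - W \<omega>\<bar> ^ 3 / 3"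
      using G_taylor[of "W' \<omega>" "W \<omega>"] by (auto simp: abs_mult)
    have 2: "\<bar>lam * ((R1 1 \<omega> - R1 (-1) \<omega>) * f (W \<omega>))\<bar> \<le> lam * \<bar>R1 1 \<omega> - R1 (-1) \<omega>\<bar>"
      using f_le[of "W \<omega>"] pos by (auto simp: abs_mult mult_left_le)
    have 3: "\<bar>lam * ((R2 1 \<omega> - R2 (-1) \<omega>) * f' (W \<omega>) / 2)\<bar> \<le> lam * q / 2 * \<bar>R2 1 \<omega> - R2 (-1) \<omega>\<bar>"
      using mult_left_mono[OF f'_le[of "W \<omega>"], of "lam * \<bar>R2 1 \<omega> - R2 (-1) \<omega>\<bar> / 2"] pos
      by (simp add: abs_mult mult_ac)
    have "drift 1 \<omega> - drift (-1) \<omega> = lam * ((R2 1 \<omega> - R2 (-1) \<omega>) * f' (W \<omega>) / 2) - lam * ((R1 1 \<omega> - R1 (-1) \<omega>) * f (W \<omega>))"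
      by (simp add: drift_def algebra_simps diff_divide_distrib)
    with 1 2 3 have "\<bar>(drift 1 \<omega> - drift (-1) \<omega>) + (?d 1 \<omega> - ?d (-1) \<omega>) * ?r \<omega>\<bar> \<le> defect \<omega>"
      unfolding defect_def by linarith
    then have "?c \<omega> * \<bar>(drift 1 \<omega> - drift (-1) \<omega>) + (?d 1 \<omega> - ?d (-1) \<omega>) * ?r \<omega>\<bar> \<le> ?c \<omega> * defect \<omega>"
      by (rule mult_left_mono) simp
    moreover have "?c \<omega> * drift 1 \<omega> + ?c \<omega> * (?d 1 \<omega> * ?r \<omega>) - (?c \<omega> * drift (-1) \<omega> + ?c \<omega> * (?d (-1) \<omega> * ?r \<omega>))
        = ?c \<omega> * ((drift 1 \<omega> - drift (-1) \<omega>) + (?d 1 \<omega> - ?d (-1) \<omega>) * ?r \<omega>)"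
      by (simp add: algebra_simps)
    ultimately show "\<bar>?c \<omega> * drift 1 \<omega> + ?c \<omega> * (?d 1 \<omega> * ?r \<omega>) - (?c \<omega> * drift (-1) \<omega> + ?c \<omega> * (?d (-1) \<omega> * ?r \<omega>))\<bar>
        \<le> ?c \<omega> * defect \<omega>"
      by (simp only: abs_mult) simp
  qed (use i1[of 1] i1[of "-1"] i2 i3 in auto)
qed

text \<open>For each outcome the indicator of \<open>Y \<omega> = k - real n\<close> is 0 as soon as
  \<open>n > k - Y \<omega>\<close>; the increment of \<open>G\<close> dominates.\<close>

lemma flow_tendsto_0: "(\<lambda>n. flow (k - real n) s) \<longlonglongrightarrow> 0"
proof -
  have "(\<lambda>n. flow (k - real n) s) \<longlonglongrightarrow> (\<integral>\<omega>. 0 \<partial>M)"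
    unfolding flow_def
  proof (rule integral_dominated_convergence)
    show "integrable M (\<lambda>\<omega>. \<bar>G (W' \<omega>) - G (W \<omega>)\<bar>)"
      using G_step_int by (rule integrable_abs)
    show "AE \<omega> in M. (\<lambda>n. of_bool (Y \<omega> = k - real n) * of_bool (Y' \<omega> - Y \<omega> = s) * (G (W' \<omega>) - G (W \<omega>))) \<longlonglongrightarrow> 0"
    proof (rule AE_I2)
      fix \<omega>
      have "\<forall>\<^sub>F n in sequentially. of_bool (Y \<omega> = k - real n) * of_bool (Y' \<omega> - Y \<omega> = s) * (G (W' \<omega>) - G (W \<omega>)) = 0"
        using eventually_gt_at_top[of "nat \<lceil>k - Y \<omega>\<rceil>"]
      proof eventually_elim
        case (elim n)
        then have "k - Y \<omega> < real n" by linarith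
        then show ?case by simp
      qed
      then show "(\<lambda>n. of_bool (Y \<omega> = k - real n) * of_bool (Y' \<omega> - Y \<omega> = s) * (G (W' \<omega>) - G (W \<omega>))) \<longlonglongrightarrow> 0"
        by (rule tendsto_eventually)
    qed
  qed auto
  then show ?thesis by simp
qed

text \<open>Each step down by one level uses \<open>flow_backward\<close> and then
  \<open>flow_diff\<close>, and adds the defect on a fresh level below \<open>k\<close>. The flow
  left over after \<open>n\<close> steps tends to 0.\<close>

lemma flow_bound: "\<bar>flow k (-1)\<bar> \<le> (\<integral>\<omega>. of_bool (Y \<omega> < k) * defect \<omega> \<partial>M)"
proof -
  have int: "integrable M (\<lambda>\<omega>. of_bool (P \<omega>) * defect \<omega>)" if [measurable]: "Measurable.pred M P" for P
    using defect_int by (intro integrable_bounded_mult[where b=1]) auto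
  have step: "\<bar>flow k (-1)\<bar> \<le> \<bar>flow (k - real n) (-1)\<bar> + (\<integral>\<omega>. of_bool (k - real n \<le> Y \<omega> \<and> Y \<omega> < k) * defect \<omega> \<partial>M)" for n
  proof (induction n)
    case 0
    then show ?case by (auto intro!: Bochner_Integration.integral_nonneg simp: defect_nonneg)
  next
    case (Suc n)
    have "\<bar>flow (k - real n) (-1)\<bar> \<le> \<bar>flow (k - real (Suc n)) (-1)\<bar> + (\<integral>\<omega>. of_bool (Y \<omega> = k - real (Suc n)) * defect \<omega> \<partial>M)"
      using flow_backward[of "k - real n"] flow_diff[of "k - real (Suc n)"] by (simp add: algebra_simps)
    \<comment> \<open>The new level is disjoint from the strip already collected, and both lie in
      the next strip.\<close>
    moreover have "(\<integral>\<omega>. of_bool (Y \<omega> = k - real (Suc n)) * defect \<omega> \<partial>M)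
        + (\<integral>\<omega>. of_bool (k - real n \<le> Y \<omega> \<and> Y \<omega> < k) * defect \<omega> \<partial>M)
        \<le> (\<integral>\<omega>. of_bool (k - real (Suc n) \<le> Y \<omega> \<and> Y \<omega> < k) * defect \<omega> \<partial>M)"
      using defect_nonneg
      by (subst Bochner_Integration.integral_add[symmetric]) (auto intro!: integral_mono int Bochner_Integration.integrable_add)
    ultimately show ?case using Suc by linarith
  qed
  have "\<bar>flow k (-1)\<bar> - (\<integral>\<omega>. of_bool (Y \<omega> < k) * defect \<omega> \<partial>M) \<le> \<bar>flow (k - real n) (-1)\<bar>" for n
  proof -
    have "(\<integral>\<omega>. of_bool (k - real n \<le> Y \<omega> \<and> Y \<omega> < k) * defect \<omega> \<partial>M) \<le> (\<integral>\<omega>. of_bool (Y \<omega> < k) * defect \<omega> \<partial>M)"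
      using defect_nonneg by (auto intro!: integral_mono int)
    with step[of n] show ?thesis by linarith
  qed
  then have "\<bar>flow k (-1)\<bar> - (\<integral>\<omega>. of_bool (Y \<omega> < k) * defect \<omega> \<partial>M) \<le> 0"
    using tendsto_rabs_zero[OF flow_tendsto_0[of k "-1"]] by (intro tendsto_lowerbound[where f="\<lambda>n. \<bar>flow (k - real n) (-1)\<bar>"]) auto
  then show ?thesis by simp
qed

text \<open>The integral of \<open>drift (-1)\<close> over \<open>{Y = k}\<close> differs from
  \<open>flow k (-1)\<close> by a remainder on \<open>{Y = k}\<close>, and \<open>flow_bound\<close>
  controls the flow by defects on \<open>{Y < k}\<close>. Solving for the Stein operator and
  clearing \<open>lam\<close> and the factor 1/2 gives the coefficients.\<close>

lemma stein_operator_bound: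
  "psi * \<bar>\<integral>\<omega>. of_bool (Y \<omega> = k) * (f' (W \<omega>) - W \<omega> * f (W \<omega>)) \<partial>M\<bar>
    \<le> 2 * ((\<integral>\<omega>. of_bool (Y \<omega> = k) * \<bar>R1 (-1) \<omega>\<bar> \<partial>M) + (\<integral>\<omega>. \<bar>R1 1 \<omega> - R1 (-1) \<omega>\<bar> \<partial>M))
      + q * ((\<integral>\<omega>. of_bool (Y \<omega> = k) * \<bar>R2 (-1) \<omega>\<bar> \<partial>M) + (\<integral>\<omega>. \<bar>R2 1 \<omega> - R2 (-1) \<omega>\<bar> \<partial>M))
      + 2 / (3 * lam) * (\<integral>\<omega>. \<bar>W' \<omega> - W \<omega>\<bar> ^ 3 \<partial>M)"
proof -
  let ?c = "\<lambda>\<omega>. of_bool (Y \<omega> = k) :: real" and ?L = "\<lambda>\<omega>. of_bool (Y \<omega> < k) :: real"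
  have int: "integrable M (\<lambda>\<omega>. of_bool (P \<omega>) * g \<omega>)" if [measurable]: "Measurable.pred M P" and "integrable M g" for P and g :: "'a \<Rightarrow> real"
    using that by (intro integrable_bounded_mult[where b=1]) auto
  have f_int: "integrable M (\<lambda>\<omega>. f (W \<omega>) * R1 (-1) \<omega>)" "integrable M (\<lambda>\<omega>. f' (W \<omega>) * R2 (-1) \<omega>)"
     "integrable M (\<lambda>\<omega>. f (W \<omega>) * W \<omega>)" "integrable M (\<lambda>\<omega>. f' (W \<omega>) * 1)"
    using W_int R_int[of "-1"] f'_mult_int[of "\<lambda>_. 1"] by (auto intro: f_mult_int f'_mult_int)
  have ci: "integrable M (\<lambda>\<omega>. ?c \<omega> * (f' (W \<omega>) - W \<omega> * f (W \<omega>)))"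
    using f_int by (intro int) (auto simp: mult.commute)
  have c1: "integrable M (\<lambda>\<omega>. ?c \<omega> * (f (W \<omega>) * R1 (-1) \<omega>))" and c2: "integrable M (\<lambda>\<omega>. ?c \<omega> * (f' (W \<omega>) * R2 (-1) \<omega>))"
    using f_int by (auto intro!: int)
  have cR: "integrable M (\<lambda>\<omega>. ?c \<omega> * \<bar>R1 (-1) \<omega>\<bar>)" "integrable M (\<lambda>\<omega>. ?c \<omega> * \<bar>R2 (-1) \<omega>\<bar>)"
    using R_int[of "-1"] by (auto intro!: int)
  define X where "X = (\<integral>\<omega>. ?c \<omega> * (f' (W \<omega>) - W \<omega> * f (W \<omega>)) \<partial>M)"
  have "(\<integral>\<omega>. ?c \<omega> * drift (-1) \<omega> \<partial>M) = (\<integral>\<omega>. lam * (psi / 2 * (?c \<omega> * (f' (W \<omega>) - W \<omega> * f (W \<omega>)))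
      - ?c \<omega> * (f (W \<omega>) * R1 (-1) \<omega>) + ?c \<omega> * (f' (W \<omega>) * R2 (-1) \<omega>) / 2) \<partial>M)"
    by (intro Bochner_Integration.integral_cong refl) (simp add: drift_def algebra_simps)
  also have "\<dots> = lam * (psi / 2 * X - (\<integral>\<omega>. ?c \<omega> * (f (W \<omega>) * R1 (-1) \<omega>) \<partial>M)
      + (\<integral>\<omega>. ?c \<omega> * (f' (W \<omega>) * R2 (-1) \<omega>) \<partial>M) / 2)"
    unfolding X_def using ci c1 c2 by simp
  finally have drift: "(\<integral>\<omega>. ?c \<omega> * drift (-1) \<omega> \<partial>M) = lam * (psi / 2 * X - (\<integral>\<omega>. ?c \<omega> * (f (W \<omega>) * R1 (-1) \<omega>) \<partial>M)
      + (\<integral>\<omega>. ?c \<omega> * (f' (W \<omega>) * R2 (-1) \<omega>) \<partial>M) / 2)" .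
  have b1: "\<bar>\<integral>\<omega>. ?c \<omega> * (f (W \<omega>) * R1 (-1) \<omega>) \<partial>M\<bar> \<le> (\<integral>\<omega>. ?c \<omega> * \<bar>R1 (-1) \<omega>\<bar> \<partial>M)"
    using c1 cR(1) f_le by (intro abs_integral_le_integral) (auto simp: abs_mult mult_left_le_one_le)
  have b2: "\<bar>\<integral>\<omega>. ?c \<omega> * (f' (W \<omega>) * R2 (-1) \<omega>) \<partial>M\<bar> \<le> (\<integral>\<omega>. q * (?c \<omega> * \<bar>R2 (-1) \<omega>\<bar>) \<partial>M)"
    using c2 cR(2) f'_le by (intro abs_integral_le_integral) (auto simp: abs_mult intro!: mult_right_mono)
  have b2': "(\<integral>\<omega>. q * (?c \<omega> * \<bar>R2 (-1) \<omega>\<bar>) \<partial>M) = q * (\<integral>\<omega>. ?c \<omega> * \<bar>R2 (-1) \<omega>\<bar> \<partial>M)" by simp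
  have b3: "\<bar>flow k (-1) - (\<integral>\<omega>. ?c \<omega> * drift (-1) \<omega> \<partial>M)\<bar> \<le> (\<integral>\<omega>. ?c \<omega> * (\<bar>W' \<omega> - W \<omega>\<bar> ^ 3 / 3) \<partial>M)"
    unfolding flow_drift[of "-1", simplified]
  proof (rule abs_integral_le_integral)
    show "integrable M (\<lambda>\<omega>. ?c \<omega> * (of_bool (Y' \<omega> - Y \<omega> = - 1) * (G (W' \<omega>) - G (W \<omega>) - f (W \<omega>) * (W' \<omega> - W \<omega>) - f' (W \<omega>) * (W' \<omega> - W \<omega>)\<^sup>2 / 2)))"
      using rem_int by (intro int) auto
    show "integrable M (\<lambda>\<omega>. ?c \<omega> * (\<bar>W' \<omega> - W \<omega>\<bar> ^ 3 / 3))" using step_int by (intro int) auto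
    show "\<bar>?c \<omega> * (of_bool (Y' \<omega> - Y \<omega> = - 1) * (G (W' \<omega>) - G (W \<omega>) - f (W \<omega>) * (W' \<omega> - W \<omega>) - f' (W \<omega>) * (W' \<omega> - W \<omega>)\<^sup>2 / 2))\<bar>
        \<le> ?c \<omega> * (\<bar>W' \<omega> - W \<omega>\<bar> ^ 3 / 3)" for \<omega>
      using G_taylor[of "W' \<omega>" "W \<omega>"] by (auto simp: abs_mult)
  qed
  \<comment> \<open>The cubic term is a summand of \<open>defect\<close>, and \<open>{Y < k}\<close>
    and \<open>{Y = k}\<close> are disjoint, so both errors fit under one expectation of
    \<open>defect\<close>. Bounding them separately would double the coefficient of the third
    moment.\<close>
  have "(\<integral>\<omega>. ?L \<omega> * defect \<omega> \<partial>M) + (\<integral>\<omega>. ?c \<omega> * (\<bar>W' \<omega> - W \<omega>\<bar> ^ 3 / 3) \<partial>M)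
      = (\<integral>\<omega>. ?L \<omega> * defect \<omega> + ?c \<omega> * (\<bar>W' \<omega> - W \<omega>\<bar> ^ 3 / 3) \<partial>M)"
    using defect_int step_int by (intro Bochner_Integration.integral_add[symmetric] int) auto
  also have "\<dots> \<le> (\<integral>\<omega>. defect \<omega> \<partial>M)"
  proof (rule integral_mono)
    show "integrable M (\<lambda>\<omega>. ?L \<omega> * defect \<omega> + ?c \<omega> * (\<bar>W' \<omega> - W \<omega>\<bar> ^ 3 / 3))"
      using defect_int step_int by (intro Bochner_Integration.integrable_add int) auto
    show "?L \<omega> * defect \<omega> + ?c \<omega> * (\<bar>W' \<omega> - W \<omega>\<bar> ^ 3 / 3) \<le> defect \<omega>" for \<omega>
    proof -
      have "\<bar>W' \<omega> - W \<omega>\<bar> ^ 3 / 3 \<le> defect \<omega>"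
        unfolding defect_def using pos q_nonneg by simp
      then show ?thesis using defect_nonneg[of \<omega>] by auto
    qed
  qed (rule defect_int)
  also have "\<dots> = lam * (\<integral>\<omega>. \<bar>R1 1 \<omega> - R1 (-1) \<omega>\<bar> \<partial>M) + lam * q / 2 * (\<integral>\<omega>. \<bar>R2 1 \<omega> - R2 (-1) \<omega>\<bar> \<partial>M)
      + (\<integral>\<omega>. \<bar>W' \<omega> - W \<omega>\<bar> ^ 3 \<partial>M) / 3"
    unfolding defect_def using R_int step_int by simp
  finally have b4: "(\<integral>\<omega>. ?L \<omega> * defect \<omega> \<partial>M) + (\<integral>\<omega>. ?c \<omega> * (\<bar>W' \<omega> - W \<omega>\<bar> ^ 3 / 3) \<partial>M) \<le> \<dots>" .
  let ?S = "\<integral>\<omega>. \<bar>W' \<omega> - W \<omega>\<bar> ^ 3 \<partial>M" and ?C = "\<integral>\<omega>. \<bar>R1 1 \<omega> - R1 (-1) \<omega>\<bar> \<partial>M" and ?D = "\<integral>\<omega>. \<bar>R2 1 \<omega> - R2 (-1) \<omega>\<bar> \<partial>M"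
  define i1 i2 where "i1 = (\<integral>\<omega>. ?c \<omega> * (f (W \<omega>) * R1 (-1) \<omega>) \<partial>M)" and "i2 = (\<integral>\<omega>. ?c \<omega> * (f' (W \<omega>) * R2 (-1) \<omega>) \<partial>M)"
  have "lam * \<bar>psi / 2 * X - i1 + i2 / 2\<bar> \<le> lam * (?C + q / 2 * ?D + ?S / (3 * lam))"
  proof -
    have "lam * \<bar>psi / 2 * X - i1 + i2 / 2\<bar> = \<bar>\<integral>\<omega>. ?c \<omega> * drift (-1) \<omega> \<partial>M\<bar>"
      unfolding drift i1_def i2_def using pos by (simp add: abs_mult)
    also have "\<dots> \<le> lam * ?C + lam * q / 2 * ?D + ?S / 3"
      using b3 b4 flow_bound[of k] by linarith
    also have "\<dots> = lam * (?C + q / 2 * ?D + ?S / (3 * lam))"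
      using pos by (simp add: field_simps)
    finally show ?thesis .
  qed
  then have "\<bar>psi / 2 * X - i1 + i2 / 2\<bar> \<le> ?C + q / 2 * ?D + ?S / (3 * lam)"
    using pos by simp
  then have "\<bar>psi * X\<bar> \<le> 2 * ?C + q * ?D + 2 * (?S / (3 * lam)) + 2 * \<bar>i1\<bar> + \<bar>i2\<bar>"
    by linarith
  then show ?thesis
    using b1 b2[unfolded b2'] pos unfolding X_def[symmetric] i1_def[symmetric] i2_def[symmetric]
    by (simp add: abs_mult algebra_simps)
qed

end

text \<open>Stein's equation identifies the integrand of \<open>stein_operator_bound\<close> with
  \<open>h (W \<omega>)\<close> minus the normal mean of \<open>h\<close>; dividing by
  \<open>psi\<close> and the probability of \<open>Bk\<close> conditions on the event. The earlier
  parameter \<open>q\<close> becomes \<open>sqrt (2/pi)\<close>.\<close>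

lemma cond_exp_lipschitz_bound:
  assumes lip: "lipschitz1 h" and k: "measure M {\<omega> \<in> space M. Y \<omega> = k} > 0"
  defines "Bk \<equiv> {\<omega> \<in> space M. Y \<omega> = k}"
  shows "\<bar>cond_exp_event M (\<lambda>\<omega>. h (W \<omega>)) Bk - std_normal_mean h\<bar>
    \<le> 2 / psi * (cond_exp_event M (\<lambda>\<omega>. \<bar>R1 (-1) \<omega>\<bar>) Bk + (\<integral>\<omega>. \<bar>R1 1 \<omega> - R1 (-1) \<omega>\<bar> \<partial>M) / measure M Bk)
      + sqrt (2 / (pi * psi\<^sup>2)) * (cond_exp_event M (\<lambda>\<omega>. \<bar>R2 (-1) \<omega>\<bar>) Bk + (\<integral>\<omega>. \<bar>R2 1 \<omega> - R2 (-1) \<omega>\<bar> \<partial>M) / measure M Bk)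
      + 2 / (3 * lam * psi * measure M Bk) * (\<integral>\<omega>. \<bar>W' \<omega> - W \<omega>\<bar> ^ 3 \<partial>M)"
proof -
  obtain f f' :: "real \<Rightarrow> real"
    where f: "\<And>x. (f has_real_derivative f' x) (at x)"
      and stein: "\<And>x. f' x - x * f x = h x - std_normal_mean h"
      and f_le: "\<And>x. \<bar>f x\<bar> \<le> 1" and f'_le: "\<And>x. \<bar>f' x\<bar> \<le> sqrt (2 / pi)"
      and f'_lip: "\<And>x y. \<bar>f' x - f' y\<bar> \<le> 2 * \<bar>x - y\<bar>"
    by (rule stein_equation_lipschitz[OF lip]) blast
  have "continuous_on UNIV f" using f by (auto intro!: DERIV_continuous_on)
  then obtain G where G: "\<And>x. (G has_real_derivative f x) (at x)"
    by (rule continuous_antiderivative) blast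
  define p where "p = measure M Bk"
  have p: "p > 0" using k by (simp add: p_def Bk_def)
  have [measurable]: "Bk \<in> sets M" unfolding Bk_def by measurable
  have cond: "cond_exp_event M X Bk = (\<integral>\<omega>. of_bool (Y \<omega> = k) * X \<omega> \<partial>M) / p" for X
    unfolding cond_exp_event_def p_def
    by (intro arg_cong2[where f="(/)"] refl Bochner_Integration.integral_cong) (auto simp: Bk_def indicator_def)
  have [measurable]: "h \<in> borel_measurable borel"
    using lipschitz1_continuous[OF lip] by (rule borel_measurable_continuous_onI)
  have h_int: "integrable M (\<lambda>\<omega>. h (W \<omega>))"
  proof (rule Bochner_Integration.integrable_bound[where f="\<lambda>\<omega>. \<bar>h 0\<bar> + \<bar>W \<omega>\<bar>"])
    have "\<bar>h x\<bar> \<le> \<bar>h 0\<bar> + \<bar>x\<bar>" for x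
      using lip[unfolded lipschitz1_def, rule_format, of x 0] by simp
    then show "AE \<omega> in M. norm (h (W \<omega>)) \<le> norm (\<bar>h 0\<bar> + \<bar>W \<omega>\<bar>)" by simp
  qed (use W_int in auto)
  have "(\<integral>\<omega>. of_bool (Y \<omega> = k) \<partial>M) = p"
  proof -
    have "(\<integral>\<omega>. of_bool (Y \<omega> = k) \<partial>M) = (\<integral>\<omega>. indicat_real Bk \<omega> \<partial>M)"
      by (intro Bochner_Integration.integral_cong) (auto simp: Bk_def indicator_def)
    then show ?thesis by (simp add: p_def)
  qed
  moreover have "integrable M (\<lambda>\<omega>. of_bool (Y \<omega> = k) * h (W \<omega>))" "integrable M (\<lambda>\<omega>. of_bool (Y \<omega> = k) * std_normal_mean h)"
    using h_int by (intro integrable_bounded_mult[where b=1]; simp)+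
  ultimately have "(\<integral>\<omega>. of_bool (Y \<omega> = k) * (f' (W \<omega>) - W \<omega> * f (W \<omega>)) \<partial>M)
      = (\<integral>\<omega>. of_bool (Y \<omega> = k) * h (W \<omega>) \<partial>M) - std_normal_mean h * p"
    unfolding stein by (simp add: right_diff_distrib)
  then have eq: "cond_exp_event M (\<lambda>\<omega>. h (W \<omega>)) Bk - std_normal_mean h
      = (\<integral>\<omega>. of_bool (Y \<omega> = k) * (f' (W \<omega>) - W \<omega> * f (W \<omega>)) \<partial>M) / p"
    unfolding cond using p by (simp add: field_simps)
  have sq: "sqrt (2 / (pi * psi\<^sup>2)) = sqrt (2 / pi) / psi"
    using pos by (simp add: real_sqrt_divide real_sqrt_mult)
  have final: "\<bar>x / p\<bar> \<le> 2 / psi * (a / p + c / p) + q / psi * (b / p + d / p) + 2 / (3 * lam * psi * p) * e"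
    if "psi * \<bar>x\<bar> \<le> 2 * (a + c) + q * (b + d) + 2 / (3 * lam) * e" for x a b c d e q
  proof -
    have "\<bar>x / p\<bar> = psi * \<bar>x\<bar> / (psi * p)" using pos p by (simp add: abs_divide)
    also have "\<dots> \<le> (2 * (a + c) + q * (b + d) + 2 / (3 * lam) * e) / (psi * p)"
      using that pos p by (intro divide_right_mono) auto
    also have "\<dots> = 2 / psi * (a / p + c / p) + q / psi * (b / p + d / p) + 2 / (3 * lam * psi * p) * e"
      using pos p by (simp add: field_simps)
    finally show ?thesis .
  qed
  show ?thesis
    unfolding eq unfolding cond sq p_def[symmetric]
    by (rule final[OF stein_operator_bound[OF f G f_le f'_le f'_lip]])
qed

end

text \<open>The third moment is an extended nonnegative integral because it may be infinite. When it
  is finite, the proof derives integrability of the remainders from (III) and (IV), so the Bochner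
  integrals behind \<open>A\<close>, \<open>B\<close>, \<open>C\<close>, \<open>D\<close> are
  genuine and not the default value 0.\<close>

theorem theorem2p1:
  fixes M :: "'a measure"
    and W Y W' Y' :: "'a \<Rightarrow> real"
    and R0p R0m R1p R1m R2p R2m :: "'a \<Rightarrow> real"
    and zeta lam psi k :: real
  assumes "prob_space M"
    and meas: "W \<in> borel_measurable M" "Y \<in> borel_measurable M"
              "W' \<in> borel_measurable M" "Y' \<in> borel_measurable M"
    \<comment> \<open>(I)\<close>
    and "integrable M W" "integrable M (\<lambda>\<omega>. W \<omega> ^ 2)"
    and "integrable M Y" "integrable M (\<lambda>\<omega>. Y \<omega> ^ 2)"
    and "prob_space.expectation M W = 0" "prob_space.variance M W = 1"
    and "prob_space.expectation M Y = 0"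
    and "prob_space.expectation M (\<lambda>\<omega>. W \<omega> * Y \<omega>) = 0"
    and exch: "distr M borel (\<lambda>\<omega>. (W \<omega>, Y \<omega>, W' \<omega>, Y' \<omega>))
             = distr M borel (\<lambda>\<omega>. (W' \<omega>, Y' \<omega>, W \<omega>, Y \<omega>))"
    \<comment> \<open>(II)\<close>
    and "0 \<le> zeta" "zeta < 1"
    and "AE \<omega> in M. Y \<omega> - zeta \<in> \<int>"
    and "AE \<omega> in M. Y' \<omega> - Y \<omega> \<in> {-1, 0, 1}"
    and "0 < lam" "lam < 1"
    and "R0p \<in> borel_measurable M" "R0m \<in> borel_measurable M"
    and "AE \<omega> in M. Mcond M W Y W' Y' 0 1 \<omega> = lam * prob_space.variance M Y + R0p \<omega>"
    and "AE \<omega> in M. Mcond M W Y W' Y' 0 (-1) \<omega> = lam * prob_space.variance M Y + R0m \<omega>"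
    \<comment> \<open>(III)\<close>
    and "0 < psi"
    and "R1p \<in> borel_measurable M" "R1m \<in> borel_measurable M"
    and "AE \<omega> in M. Mcond M W Y W' Y' 1 1 \<omega> = - lam * (psi * W \<omega> / 2 + R1p \<omega>)"
    and "AE \<omega> in M. Mcond M W Y W' Y' 1 (-1) \<omega> = - lam * (psi * W \<omega> / 2 + R1m \<omega>)"
    \<comment> \<open>(IV)\<close>
    and "R2p \<in> borel_measurable M" "R2m \<in> borel_measurable M"
    and "AE \<omega> in M. Mcond M W Y W' Y' 2 1 \<omega> = lam * (psi + R2p \<omega>)"
    and "AE \<omega> in M. Mcond M W Y W' Y' 2 (-1) \<omega> = lam * (psi + R2m \<omega>)"
    \<comment> \<open>the value k\<close>
    and pk: "measure M {\<omega> \<in> space M. Y \<omega> = k} > 0"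
  shows "let Bk = {\<omega> \<in> space M. Y \<omega> = k};
             p = measure M Bk;
             A = cond_exp_event M (\<lambda>\<omega>. \<bar>R1m \<omega>\<bar>) Bk;
             B = cond_exp_event M (\<lambda>\<omega>. \<bar>R2m \<omega>\<bar>) Bk;
             C = prob_space.expectation M (\<lambda>\<omega>. \<bar>R1p \<omega> - R1m \<omega>\<bar>);
             D = prob_space.expectation M (\<lambda>\<omega>. \<bar>R2p \<omega> - R2m \<omega>\<bar>)
         in dW_cond_normal M W Bk
            \<le> ennreal (2 / psi * (A + C / p) + sqrt (2 / (pi * psi\<^sup>2)) * (B + D / p))
               + ennreal (2 / (3 * lam * psi * p)) * (\<integral>\<^sup>+ \<omega>. ennreal (\<bar>W' \<omega> - W \<omega>\<bar> ^ 3) \<partial>M)"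
proof -
  interpret prob_space M by fact
  note [measurable] = meas
  define Bk where "Bk = {\<omega> \<in> space M. Y \<omega> = k}"
  define R1 R2 where "R1 = (\<lambda>s::real. if s = 1 then R1p else R1m)" and "R2 = (\<lambda>s::real. if s = 1 then R2p else R2m)"
  have R_eq: "R1 1 = R1p" "R1 (-1) = R1m" "R2 1 = R2p" "R2 (-1) = R2m" by (simp_all add: R1_def R2_def)
  have p: "measure M Bk > 0" using pk by (simp add: Bk_def)
  let ?S = "\<integral>\<^sup>+ \<omega>. ennreal (\<bar>W' \<omega> - W \<omega>\<bar> ^ 3) \<partial>M"
  let ?E = "2 / psi * (cond_exp_event M (\<lambda>\<omega>. \<bar>R1m \<omega>\<bar>) Bk + expectation (\<lambda>\<omega>. \<bar>R1p \<omega> - R1m \<omega>\<bar>) / measure M Bk)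
      + sqrt (2 / (pi * psi\<^sup>2)) * (cond_exp_event M (\<lambda>\<omega>. \<bar>R2m \<omega>\<bar>) Bk + expectation (\<lambda>\<omega>. \<bar>R2p \<omega> - R2m \<omega>\<bar>) / measure M Bk)"
  let ?K = "2 / (3 * lam * psi * measure M Bk)"
  have K: "?K > 0" using p \<open>0 < lam\<close> \<open>0 < psi\<close> by simp
  have "dW_cond_normal M W Bk \<le> ennreal ?E + ennreal ?K * ?S"
  proof (cases "?S = \<infinity>")
    case True
    \<comment> \<open>In \<open>ennreal\<close> zero times infinity is 0, so the trivial case rests
      on strict positivity of the coefficient.\<close>
    have "ennreal ?K \<noteq> 0" using K by (simp only: ennreal_eq_0_iff not_le)
    then have "ennreal ?K * ?S = \<top>" using True by (simp only: ennreal_mult_eq_top_iff) simp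
    then show ?thesis by simp
  next
    case False
    have cube: "integrable M (\<lambda>\<omega>. \<bar>W' \<omega> - W \<omega>\<bar> ^ 3)"
      using False by (intro integrableI_bounded) (auto simp: top.not_eq_extremum)
    have powers: "integrable M (\<lambda>\<omega>. (W' \<omega> - W \<omega>) ^ l)" if "l \<le> 3" for l
      by (rule integrable_power_le_3[OF _ cube that]) measurable
    have M1: "AE \<omega> in M. Mcond M W Y W' Y' 1 s \<omega> = - lam * (psi * W \<omega> / 2 + R1 s \<omega>)"
      and M2: "AE \<omega> in M. Mcond M W Y W' Y' 2 s \<omega> = lam * (psi + R2 s \<omega>)" if "s \<in> {1, -1}" for s
      using that assms by (auto simp: R1_def R2_def)
    have [measurable]: "R1 s \<in> borel_measurable M" "R2 s \<in> borel_measurable M" for s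
      using assms by (auto simp: R1_def R2_def)
    have M_int: "integrable M (Mcond M W Y W' Y' l s)" if "l \<le> 3" for l s
      \<comment> \<open>Only the integrability conclusion is wanted, so the zero test function
        serves.\<close>
      using powers[OF that] by (intro Mcond_integral(1)[where v="\<lambda>_. 0" and b=0]) auto
    have [measurable]: "Mcond M W Y W' Y' l s \<in> borel_measurable M" for l s
      unfolding Mcond_def by (rule borel_measurable_cond_exp2)
    interpret stein_pair M W Y W' Y' R1 R2 lam psi
    proof
      fix s :: real assume s: "s \<in> {1, -1}"
      \<comment> \<open>This is (III) solved for \<open>R1 s\<close>.\<close>
      have "integrable M (\<lambda>\<omega>. - (Mcond M W Y W' Y' 1 s \<omega> / lam) - psi * W \<omega> / 2)"
        using M_int[of 1 s] \<open>integrable M W\<close> by simp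
      then show "integrable M (R1 s)"
        by (rule Bochner_Integration.integrable_cong_AE[THEN iffD1, rotated -1])
           (use M1[OF s] \<open>0 < lam\<close> in \<open>auto elim!: eventually_mono simp: field_simps\<close>)
      have "integrable M (\<lambda>\<omega>. Mcond M W Y W' Y' 2 s \<omega> / lam - psi)"
        using M_int[of 2 s] by simp
      then show "integrable M (R2 s)"
        by (rule Bochner_Integration.integrable_cong_AE[THEN iffD1, rotated -1])
           (use M2[OF s] \<open>0 < lam\<close> in \<open>auto elim!: eventually_mono simp: field_simps\<close>)
      fix v :: "real \<Rightarrow> real" and b j
      assume v [measurable]: "v \<in> borel_measurable borel" and b: "\<And>x. \<bar>v x\<bar> \<le> b"
      have "expectation (\<lambda>\<omega>. of_bool (Y \<omega> = j) * v (W \<omega>) * Mcond M W Y W' Y' 1 s \<omega>)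
          = expectation (\<lambda>\<omega>. of_bool (Y \<omega> = j) * v (W \<omega>) * (- lam * (psi * W \<omega> / 2 + R1 s \<omega>)))"
        using M1[OF s] by (intro integral_cong_AE) (auto elim!: eventually_mono)
      then show "expectation (\<lambda>\<omega>. of_bool (Y \<omega> = j) * v (W \<omega>) * (of_bool (Y' \<omega> - Y \<omega> = s) * (W' \<omega> - W \<omega>)))
          = expectation (\<lambda>\<omega>. of_bool (Y \<omega> = j) * v (W \<omega>) * (- lam * (psi * W \<omega> / 2 + R1 s \<omega>)))"
        using Mcond_integral(2)[OF meas powers[of 1] v b, where s=s and j=j] by simp
      have "expectation (\<lambda>\<omega>. of_bool (Y \<omega> = j) * v (W \<omega>) * Mcond M W Y W' Y' 2 s \<omega>)
          = expectation (\<lambda>\<omega>. of_bool (Y \<omega> = j) * v (W \<omega>) * (lam * (psi + R2 s \<omega>)))"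
        using M2[OF s] by (intro integral_cong_AE) (auto elim!: eventually_mono)
      then show "expectation (\<lambda>\<omega>. of_bool (Y \<omega> = j) * v (W \<omega>) * (of_bool (Y' \<omega> - Y \<omega> = s) * (W' \<omega> - W \<omega>)\<^sup>2))
          = expectation (\<lambda>\<omega>. of_bool (Y \<omega> = j) * v (W \<omega>) * (lam * (psi + R2 s \<omega>)))"
        using Mcond_integral(2)[OF meas powers[of 2] v b, where s=s and j=j] by simp
    qed (use assms cube in auto)
    have S: "?S = ennreal (expectation (\<lambda>\<omega>. \<bar>W' \<omega> - W \<omega>\<bar> ^ 3))"
      using cube by (intro nn_integral_eq_integral) auto
    show ?thesis
      unfolding dW_cond_normal_def
    proof (rule SUP_least)
      fix h assume "h \<in> {h. lipschitz1 h}"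
      then have "\<bar>cond_exp_event M (\<lambda>\<omega>. h (W \<omega>)) Bk - std_normal_mean h\<bar> \<le> ?E + ?K * expectation (\<lambda>\<omega>. \<bar>W' \<omega> - W \<omega>\<bar> ^ 3)"
        using cond_exp_lipschitz_bound[OF _ pk] by (simp add: R_eq Bk_def)
      then have "ennreal \<bar>cond_exp_event M (\<lambda>\<omega>. h (W \<omega>)) Bk - std_normal_mean h\<bar>
          \<le> ennreal (?E + ?K * expectation (\<lambda>\<omega>. \<bar>W' \<omega> - W \<omega>\<bar> ^ 3))"
        by (rule ennreal_leI)
      also have "\<dots> = ennreal ?E + ennreal ?K * ?S"
      proof -
        have "0 \<le> ?E"
          unfolding cond_exp_event_def using \<open>0 < psi\<close>
          by (intro add_nonneg_nonneg mult_nonneg_nonneg divide_nonneg_nonneg Bochner_Integration.integral_nonneg) auto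
        moreover have "0 \<le> expectation (\<lambda>\<omega>. \<bar>W' \<omega> - W \<omega>\<bar> ^ 3)" by (rule Bochner_Integration.integral_nonneg) simp
        ultimately show ?thesis
          unfolding S using less_imp_le[OF K] by (simp only: ennreal_plus ennreal_mult mult_nonneg_nonneg)
      qed
      finally show "ennreal \<bar>cond_exp_event M (\<lambda>\<omega>. h (W \<omega>)) Bk - std_normal_mean h\<bar> \<le> ennreal ?E + ennreal ?K * ?S" .
    qed
  qed
  then show ?thesis unfolding Let_def Bk_def .
qed

end
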